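(* For every dimension $n\ge1$ there exists a constant $c$ depending only on $n$ such that for every $p\ge 1$ (with $p<\infty$), every weight $v\in A_p$ on $\mathbb{R}^n$ and every $f\in L^1(v)$, $$\left\| \frac{M_d (fv)}{v} \right\|_{L^{1, \infty}(v)}\le c\,[v]_{A_\infty}\max\{p,\,\log(e+[v]_{A_p})\}\, \|f\|_{L^1(v)}.$$
   Context: A weight is a nonnegative locally integrable function on $\mathbb{R}^n$. Cubes have sides parallel to the coordinate axes and all suprema below are over cubes $Q\subset\mathbb{R}^n$. For $1<p<\infty$, $[w]_{A_p}=\sup_Q\left(\frac1{|Q|}\int_Q w\right)\left(\frac1{|Q|}\int_Q w^{1-p'}\right)^{p-1}$ with $p'=p/(p-1)$; $[w]_{A_1}=\sup_Q\left(\frac1{|Q|}\int_Q w\right)(\operatorname{ess\,inf}_Q w)^{-1}$; $w\in A_p$ means $[w]_{A_p}<\infty$. The (Fujii–Wilson) constant is $[w]_{A_\infty}=\sup_Q\frac{1}{w(Q)}\int_Q M(\chi_Q w)\,dx$, where $w(E)=\int_E w\,dx$ and $M$ is the Hardy–Littlewood maximal operator $Mh(x)=\sup_{Q\ni x}\frac1{|Q|}\int_Q|h|$. $M_d$ is the dyadic maximal operator, defined in the same way but with the supremum over dyadic cubes containing $x$. $\|f\|_{L^1(v)}=\int|f|\,v\,dx$ and $\|F\|_{L^{1,\infty}(v)}=\sup_{t>0} t\, v(\{x:|F(x)|>t\})$. *)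

theory Defs
  imports "HOL-Analysis.Analysis"
begin

definition weight :: "(real^'n \<Rightarrow> real) \<Rightarrow> bool" where
  "weight w \<longleftrightarrow> (\<forall>x. 0 \<le> w x) \<and> (\<forall>K. compact K \<longrightarrow> w absolutely_integrable_on K)"

text \<open>Nondegenerate closed cubes. Taking closed, open or half-open cubes makes no difference to
  any of the suprema over \<open>cubes\<close> below.\<close>

definition cubes :: "(real^'n) set set" where
  "cubes = {cbox a (a + (\<chi> i. l)) | a l. 0 < l}"

text \<open>The standard dyadic grid; its cubes are half-open, so that those of one generation
  partition the space.\<close>

definition dyadic_cubes :: "(real^'n) set set" where
  "dyadic_cubes =
    {{x. \<forall>i. 2 powi k * of_int (m i) \<le> x $ i \<and> x $ i < 2 powi k * (of_int (m i) + 1)}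
      | k (m :: 'n \<Rightarrow> int). True}"

definition avg :: "(real^'n) set \<Rightarrow> (real^'n \<Rightarrow> ennreal) \<Rightarrow> ennreal" where
  "avg Q g = (\<integral>\<^sup>+x\<in>Q. g x \<partial>lebesgue) / emeasure lebesgue Q"

definition wmeas :: "(real^'n \<Rightarrow> real) \<Rightarrow> (real^'n) set \<Rightarrow> ennreal" where
  "wmeas w E = (\<integral>\<^sup>+x\<in>E. ennreal (w x) \<partial>lebesgue)"

definition maximal_op :: "(real^'n) set set \<Rightarrow> (real^'n \<Rightarrow> real) \<Rightarrow> real^'n \<Rightarrow> ennreal" where
  "maximal_op \<Q> h x = (SUP Q \<in> {Q \<in> \<Q>. x \<in> Q}. avg Q (\<lambda>y. ennreal \<bar>h y\<bar>))"

definition HL_maximal :: "(real^'n \<Rightarrow> real) \<Rightarrow> real^'n \<Rightarrow> ennreal" where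
  "HL_maximal = maximal_op cubes"

definition dyadic_maximal :: "(real^'n \<Rightarrow> real) \<Rightarrow> real^'n \<Rightarrow> ennreal" where
  "dyadic_maximal = maximal_op dyadic_cubes"

text \<open>Real powers in the extended half-line: a negative power of 0 is infinite, and a negative
  power of infinity is 0 (whereas \<open>0 powr a = 0\<close> on the reals).\<close>

definition ennreal_rpow :: "ennreal \<Rightarrow> real \<Rightarrow> ennreal" where
  "ennreal_rpow x a =
    (if a = 0 then 1
     else if x = 0 then (if 0 < a then 0 else \<infinity>)
     else if x = \<infinity> then (if 0 < a then \<infinity> else 0)
     else ennreal (enn2real x powr a))"

definition ess_inf_on :: "(real^'n) set \<Rightarrow> (real^'n \<Rightarrow> real) \<Rightarrow> ennreal" where
  "ess_inf_on Q w = Sup {c. AE x in lebesgue. x \<in> Q \<longrightarrow> c \<le> ennreal (w x)}"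

text \<open>The constants below live in \<^typ>\<open>ennreal\<close>, where \<open>0 * \<infinity> = 0\<close>, \<open>inverse 0 = \<infinity>\<close> and
  \<open>0 / 0 = 0\<close>. For a weight that vanishes on a set of positive measure without vanishing almost
  everywhere, large cubes still make the \<open>A\<^sub>p\<close> constant infinite; only for weights that are zero
  almost everywhere does the convention \<open>0 * \<infinity> = 0\<close> affect the suprema, which are then 0.\<close>

definition A1_const :: "(real^'n \<Rightarrow> real) \<Rightarrow> ennreal" where
  "A1_const w = (SUP Q \<in> cubes. avg Q (\<lambda>x. ennreal (w x)) * inverse (ess_inf_on Q w))"

definition Ap_const :: "real \<Rightarrow> (real^'n \<Rightarrow> real) \<Rightarrow> ennreal" where
  "Ap_const p w =
    (if p = 1 then A1_const w
     else (let p' = p / (p - 1) in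
       SUP Q \<in> cubes. avg Q (\<lambda>x. ennreal (w x)) *
         ennreal_rpow (avg Q (\<lambda>x. ennreal_rpow (ennreal (w x)) (1 - p'))) (p - 1)))"

definition Ainf_const :: "(real^'n \<Rightarrow> real) \<Rightarrow> ennreal" where
  "Ainf_const w =
    (SUP Q \<in> cubes.
      (\<integral>\<^sup>+x\<in>Q. HL_maximal (\<lambda>y. indicator Q y * w y) x \<partial>lebesgue) / wmeas w Q)"

definition Ap_weight :: "real \<Rightarrow> (real^'n \<Rightarrow> real) \<Rightarrow> bool" where
  "Ap_weight p w \<longleftrightarrow> weight w \<and> Ap_const p w < \<infinity>"

definition L1_norm :: "(real^'n \<Rightarrow> real) \<Rightarrow> (real^'n \<Rightarrow> real) \<Rightarrow> ennreal" where
  "L1_norm v f = (\<integral>\<^sup>+x. ennreal (\<bar>f x\<bar> * v x) \<partial>lebesgue)"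

definition in_L1 :: "(real^'n \<Rightarrow> real) \<Rightarrow> (real^'n \<Rightarrow> real) \<Rightarrow> bool" where
  "in_L1 v f \<longleftrightarrow> f \<in> borel_measurable lebesgue \<and> L1_norm v f < \<infinity>"

text \<open>For functions with values in the extended half-line, so that no absolute value is needed.\<close>

definition weak_L1_norm :: "(real^'n \<Rightarrow> real) \<Rightarrow> (real^'n \<Rightarrow> ennreal) \<Rightarrow> ennreal" where
  "weak_L1_norm v F = (SUP t \<in> {0<..}. ennreal t * wmeas v {x. ennreal t < F x})"

end

theory Submission
  imports Defs
begin

text \<open>Let \<open>G = \<bar>f v\<bar> / t\<close> and \<open>a = 2 * 2 ^ n\<close>. Where \<open>a ^ k < v \<le> a ^ (k + 1)\<close> and the dyadic maximal function of
  \<open>G\<close> exceeds \<open>v\<close>, the point lies in a maximal dyadic cube \<open>Q\<close> with \<open>avg Q G > a ^ k\<close>, so it suffices to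
  sum \<open>v(Q \<inter> {v \<le> a * avg Q G})\<close> over all such cubes and all \<open>k\<close>. These cubes form a sparse family. By
  the Fujii--Wilson condition, with constant \<open>A\<close>, they satisfy a Carleson packing estimate: those with
  \<open>v(Q) \<le> a ^ m * G(Q)\<close> have total \<open>v\<close>-mass at most \<open>2 * A * a ^ m * \<integral>G\<close>. Group the cubes by
  \<open>m\<close> with \<open>G(Q) \<approx> a ^ (-m) * v(Q)\<close>. In the \<open>m\<close>-th group only points where \<open>v\<close> is at most
  \<open>s = a ^ (2 - m)\<close> times its average count, and if \<open>K\<close> bounds the \<open>A\<^sub>p\<close> constant, their proportion in \<open>Q\<close> is
  at most \<open>(s * K) powr (1 / (p - 1))\<close>. So up to a constant the group contributes
  \<open>min 1 ((s * K) powr (1 / (p - 1))) * A * \<integral>G\<close>; summing over \<open>m\<close> gives about \<open>ln K\<close> terms with minimum 1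
  and a geometric tail of size at most \<open>p\<close>. The case \<open>p = 1\<close> follows from \<open>p = 2\<close>.\<close>

section \<open>Dyadic cubes\<close>

text \<open>The dyadic cube of side \<open>2 powi j\<close> through \<open>x\<close>. Naming a cube
  by a scale and any of its points makes the ancestors of \<open>dcube j x\<close> simply
  \<open>dcube i x\<close> with \<open>i > j\<close>.\<close>

definition dcube :: "int \<Rightarrow> real^'n \<Rightarrow> (real^'n) set" where
  "dcube j x = {y. \<forall>i. \<lfloor>y $ i / 2 powi j\<rfloor> = \<lfloor>x $ i / 2 powi j\<rfloor>}"

lemma dcube_self [simp]: "x \<in> dcube j x"
  by (simp add: dcube_def)

lemma dcube_eqI: "y \<in> dcube j x \<Longrightarrow> dcube j y = dcube j x"
  by (auto simp: dcube_def)

text \<open>Nesting of dyadic intervals in one coordinate: doubling the scale halves the quotient,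
  and the floor of the half depends only on the floor.\<close>

lemma floor_half_eq:
  fixes u w :: real
  assumes "\<lfloor>u\<rfloor> = \<lfloor>w\<rfloor>"
  shows "\<lfloor>u / 2\<rfloor> = \<lfloor>w / 2\<rfloor>"
  using assms floor_divide_real_eq_div[of 2 u] floor_divide_real_eq_div[of 2 w] by simp

lemma dcube_mono_step: "dcube j x \<subseteq> dcube (j + 1) x"
proof
  fix y assume y: "y \<in> dcube j x"
  have *: "z / 2 powi (j + 1) = z / 2 powi j / 2" for z :: real
    by (simp add: power_int_add)
  show "y \<in> dcube (j + 1) x"
    using y floor_half_eq unfolding dcube_def * by blast
qed

lemma dcube_mono: "j \<le> k \<Longrightarrow> dcube j x \<subseteq> dcube k x"
proof (induction k rule: int_ge_induct)
  case (step k)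
  then show ?case using dcube_mono_step[of k x] by auto
qed simp

lemma dcube_eq_above:
  assumes "z \<in> dcube j x" "j \<le> i"
  shows "dcube i x = dcube i z"
  using dcube_eqI dcube_mono[OF assms(2)] assms(1) by blast

lemma dcube_alt:
  "dcube j x = {y. \<forall>i. 2 powi j * of_int \<lfloor>x $ i / 2 powi j\<rfloor> \<le> y $ i \<and>
                     y $ i < 2 powi j * (of_int \<lfloor>x $ i / 2 powi j\<rfloor> + 1)}"
proof -
  have p: "(0::real) < 2 powi j" by simp
  have "\<lfloor>u / 2 powi j\<rfloor> = m \<longleftrightarrow> 2 powi j * of_int m \<le> u \<and> u < 2 powi j * (of_int m + 1)" for u :: real and m
    using p by (simp add: floor_eq_iff pos_le_divide_eq pos_divide_less_eq mult.commute)
  then show ?thesis by (simp add: dcube_def)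
qed

lemma dyadic_cubes_eq: "(dyadic_cubes :: (real^'n) set set) = {dcube j x | j x. True}"
proof (intro set_eqI iffI)
  fix Q :: "(real^'n) set" assume "Q \<in> dyadic_cubes"
  then obtain k m where Q: "Q = {x. \<forall>i. 2 powi k * of_int (m i) \<le> x $ i \<and> x $ i < 2 powi k * (of_int (m i) + 1)}"
    by (auto simp: dyadic_cubes_def)
  have "Q = dcube k (\<chi> i. 2 powi k * of_int (m i))"
    by (simp add: Q dcube_alt)
  then show "Q \<in> {dcube j x | j x. True}" by blast
next
  fix Q :: "(real^'n) set" assume "Q \<in> {dcube j x | j x. True}"
  then obtain j x where Q: "Q = dcube j x" by auto
  show "Q \<in> dyadic_cubes"
    unfolding Q dyadic_cubes_def mem_Collect_eq
    by (intro exI[of _ j] exI[of _ "\<lambda>i. \<lfloor>x $ i / 2 powi j\<rfloor>"]) (simp add: dcube_alt)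
qed

lemma dcube_in_dyadic_cubes [simp]: "dcube j x \<in> dyadic_cubes"
  by (auto simp: dyadic_cubes_eq)

text \<open>Any point of a dyadic cube may serve as its base point, so dyadic cubes sharing a point
  differ only in scale.\<close>

lemma dyadic_cubes_containing:
  assumes "Q \<in> dyadic_cubes" "z \<in> Q"
  obtains j where "Q = dcube j z"
  using assms dcube_eqI unfolding dyadic_cubes_eq by blast

lemma countable_dyadic_cubes: "countable (dyadic_cubes :: (real^'n) set set)"
proof -
  have "(dyadic_cubes :: (real^'n) set set) \<subseteq>
     range (\<lambda>(k, m :: 'n \<Rightarrow> int). {x. \<forall>i. 2 powi k * of_int (m i) \<le> x $ i \<and> x $ i < 2 powi k * (of_int (m i) + 1)})"
    unfolding dyadic_cubes_def by auto
  then show ?thesis by (rule countable_subset) simp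
qed

lemma dyadic_cubes_nested:
  assumes "Q \<in> dyadic_cubes" "R \<in> dyadic_cubes" "Q \<inter> R \<noteq> {}"
  shows "Q \<subseteq> R \<or> R \<subseteq> Q"
proof -
  obtain z where z: "z \<in> Q" "z \<in> R" using assms(3) by auto
  obtain i j where "Q = dcube i z" "R = dcube j z"
    using dyadic_cubes_containing assms z by metis
  then show ?thesis using dcube_mono[of i j z] dcube_mono[of j i z] linear[of i j] by blast
qed

text \<open>Passing between a half-open dyadic cube and its closure, the cubes of \<open>cubes\<close> being closed.\<close>

lemma dcube_closure:
  fixes x :: "real^'n"
  obtains R where "R \<in> cubes" "dcube j x \<subseteq> R" "negligible (R - dcube j x)"
    "emeasure lebesgue R = ennreal ((2 powi j) ^ CARD('n))" "compact R"
proof -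
  define l :: real where "l = 2 powi j"
  define a :: "real^'n" where "a = (\<chi> i. l * of_int \<lfloor>x $ i / l\<rfloor>)"
  define R where "R = cbox a (a + (\<chi> i. l))"
  have l: "0 < l" by (simp add: l_def)
  \<comment> \<open>The half-open cube lies between the open box and its closure, so what the
    closure adds is part of a frontier and negligible.\<close>
  have box: "box a (a + (\<chi> i. l)) \<subseteq> dcube j x"
    unfolding dcube_alt l_def[symmetric] mem_box_cart a_def
    by (auto simp: mem_box_cart algebra_simps less_imp_le)
  show ?thesis
  proof
    show "R \<in> cubes" using l unfolding R_def cubes_def by blast
    show "dcube j x \<subseteq> R"
      unfolding dcube_alt l_def[symmetric] R_def a_def
      by (auto simp: mem_box_cart algebra_simps less_imp_le)
    show "negligible (R - dcube j x)"
      using negligible_subset[OF negligible_frontier_interval[of a "a + (\<chi> i. l)"]] box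
      unfolding R_def by blast
    have "emeasure lebesgue R = emeasure lborel R" unfolding R_def by simp
    also have "\<dots> = ennreal (l ^ CARD('n))"
    proof -
      have "emeasure lborel R = ennreal (measure lborel R)"
        unfolding R_def by (intro emeasure_eq_ennreal_measure) (simp add: emeasure_lborel_cbox_eq)
      moreover have "measure lborel R = l ^ CARD('n)"
        unfolding R_def using l
        by (subst content_cbox_cart) (auto simp: interval_eq_empty_cart not_less)
      ultimately show ?thesis by simp
    qed
    finally show "emeasure lebesgue R = ennreal ((2 powi j) ^ CARD('n))" by (simp add: l_def)
    show "compact R" unfolding R_def by (rule compact_cbox)
  qed
qed

lemma dcube_closure_eq:
  assumes "dcube j x \<subseteq> R" "negligible (R - dcube j x)"
  shows "AE y in lebesgue. y \<in> R \<longleftrightarrow> y \<in> dcube j x"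
proof -
  have "R - dcube j x \<in> null_sets lebesgue"
    using assms(2) negligible_iff_null_sets by blast
  then show ?thesis
    by (rule AE_I') (use assms(1) in blast)
qed

lemma dcube_measurable [measurable, simp]: "dcube j x \<in> sets lebesgue"
proof -
  obtain R where R: "R \<in> cubes" "dcube j x \<subseteq> R" "negligible (R - dcube j x)" "compact R"
    using dcube_closure[of j x] by metis
  have "R \<in> sets lebesgue" using R(4) by (simp add: lmeasurable_compact fmeasurableD)
  moreover have "R - dcube j x \<in> sets lebesgue"
    using R(3) negligible_imp_sets by blast
  moreover have "dcube j x = R - (R - dcube j x)" using R(2) by auto
  ultimately show ?thesis by (metis sets.Diff)
qed

lemma dyadic_cube_measurable: "Q \<in> dyadic_cubes \<Longrightarrow> Q \<in> sets lebesgue"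
  by (auto simp: dyadic_cubes_eq)

lemma set_nn_integral_closure:
  assumes "dcube j x \<subseteq> R" "negligible (R - dcube j x)"
  shows "(\<integral>\<^sup>+y\<in>R. g y \<partial>lebesgue) = (\<integral>\<^sup>+y\<in>dcube j x. g y \<partial>lebesgue)"
  using dcube_closure_eq[OF assms]
  by (intro nn_integral_cong_AE) (auto simp: indicator_def elim!: eventually_mono)

lemma emeasure_dcube:
  fixes x :: "real^'n"
  shows "emeasure lebesgue (dcube j x) = ennreal ((2 powi j) ^ CARD('n))"
proof -
  obtain R where R: "R \<in> cubes" "dcube j x \<subseteq> R" "negligible (R - dcube j x)"
    "emeasure lebesgue R = ennreal ((2 powi j) ^ CARD('n))" "compact R"
    by (rule dcube_closure)
  have "R \<in> sets lebesgue" using R(5) by (simp add: lmeasurable_compact fmeasurableD)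
  then show ?thesis
    using set_nn_integral_closure[OF R(2,3), of "\<lambda>_. 1"] R(4) by simp
qed

lemma dyadic_cube_closure:
  assumes "Q \<in> dyadic_cubes"
  obtains R where "R \<in> cubes" "Q \<subseteq> R" "compact R" "emeasure lebesgue R = emeasure lebesgue Q"
    "\<And>g. (\<integral>\<^sup>+y\<in>R. g y \<partial>lebesgue) = (\<integral>\<^sup>+y\<in>Q. g y \<partial>lebesgue)"
proof -
  obtain j x where Q: "Q = dcube j x" using assms by (auto simp: dyadic_cubes_eq)
  obtain R where "R \<in> cubes" "dcube j x \<subseteq> R" "negligible (R - dcube j x)"
    "emeasure lebesgue R = ennreal ((2 powi j) ^ CARD('a))" "compact R"
    by (rule dcube_closure)
  then show ?thesis
    using that[of R] set_nn_integral_closure[of j x R] unfolding Q emeasure_dcube by simp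
qed

lemma emeasure_dyadic_cube:
  assumes "Q \<in> dyadic_cubes"
  obtains r where "0 < r" "emeasure lebesgue Q = ennreal r"
proof -
  obtain j x where "Q = dcube j x" using assms by (auto simp: dyadic_cubes_eq)
  then show ?thesis using that[of "(2 powi j) ^ CARD('a)"] by (simp add: emeasure_dcube)
qed

section \<open>Stopping cubes\<close>

text \<open>Passing to the parent cube can cost a factor \<open>2 ^ n\<close> in an average; the extra factor 2 makes
  the stopping cubes of successive generations sparse.\<close>

definition stopping_ratio :: "'n itself \<Rightarrow> real" where
  "stopping_ratio _ = 2 * 2 ^ CARD('n)"

definition stopping_cubes :: "(real^'n \<Rightarrow> ennreal) \<Rightarrow> int \<Rightarrow> (real^'n) set set" where
  "stopping_cubes G k =
     {dcube j x | j x. ennreal (stopping_ratio TYPE('n) powi k) < avg (dcube j x) G \<and>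
        (\<forall>i>j. avg (dcube i x) G \<le> ennreal (stopping_ratio TYPE('n) powi k))}"

lemma stopping_ratio_ge: "4 \<le> stopping_ratio TYPE('n::finite)"
proof -
  have "(2::real) ^ 1 \<le> 2 ^ CARD('n)"
    by (intro power_increasing) (simp_all add: Suc_le_eq)
  then show ?thesis by (simp add: stopping_ratio_def)
qed

lemma stopping_cubes_dyadic: "Q \<in> stopping_cubes G k \<Longrightarrow> Q \<in> dyadic_cubes"
  by (auto simp: stopping_cubes_def)

lemma stopping_cubes_avg:
  fixes G :: "real^'n \<Rightarrow> ennreal"
  shows "Q \<in> stopping_cubes G k \<Longrightarrow> ennreal (stopping_ratio TYPE('n) powi k) < avg Q G"
  by (auto simp: stopping_cubes_def)

lemma stopping_cubes_containing:
  fixes z :: "real^'n"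
  assumes "Q \<in> stopping_cubes G k" "z \<in> Q"
  obtains j where "Q = dcube j z" "ennreal (stopping_ratio TYPE('n) powi k) < avg (dcube j z) G"
    "\<And>i. j < i \<Longrightarrow> avg (dcube i z) G \<le> ennreal (stopping_ratio TYPE('n) powi k)"
proof -
  obtain j x where Q: "Q = dcube j x" and *: "ennreal (stopping_ratio TYPE('n) powi k) < avg (dcube j x) G"
      "\<forall>i>j. avg (dcube i x) G \<le> ennreal (stopping_ratio TYPE('n) powi k)"
    using assms(1) by (auto simp: stopping_cubes_def)
  have "dcube i x = dcube i z" if "j \<le> i" for i
    using dcube_eq_above assms(2) that unfolding Q by blast
  then show ?thesis using that[of j] * Q by (simp add: less_imp_le)
qed

text \<open>At a common point both cubes would be the largest dyadic cube whose average exceeds the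
  threshold.\<close>

lemma stopping_cubes_disjoint:
  assumes "Q \<in> stopping_cubes G k" "R \<in> stopping_cubes G k" "Q \<noteq> R"
  shows "Q \<inter> R = {}"
proof (rule ccontr)
  assume "Q \<inter> R \<noteq> {}"
  then obtain z where z: "z \<in> Q" "z \<in> R" by auto
  obtain i where i: "Q = dcube i z" "ennreal (stopping_ratio TYPE('a) powi k) < avg (dcube i z) G"
    "\<And>l. i < l \<Longrightarrow> avg (dcube l z) G \<le> ennreal (stopping_ratio TYPE('a) powi k)"
    using stopping_cubes_containing[OF assms(1) z(1)] by metis
  obtain j where j: "R = dcube j z" "ennreal (stopping_ratio TYPE('a) powi k) < avg (dcube j z) G"
    "\<And>l. j < l \<Longrightarrow> avg (dcube l z) G \<le> ennreal (stopping_ratio TYPE('a) powi k)"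
    using stopping_cubes_containing[OF assms(2) z(2)] by metis
  have "i = j"
    using i(2,3) j(2,3) by (meson linorder_neqE_linordered_idom not_le)
  then show False using i(1) j(1) assms(3) by simp
qed

text \<open>For \<open>0 \<le> i\<close> the volume \<open>(2 powi i) ^ n\<close> is at least
  \<open>2 powi i\<close>. This crude decay of averages over large cubes yields the existence of
  maximal cubes.\<close>

lemma avg_dcube_le_total:
  fixes x :: "real^'n"
  assumes "0 \<le> i"
  shows "avg (dcube i x) G \<le> (\<integral>\<^sup>+x. G x \<partial>lebesgue) / ennreal (2 powi i)"
proof -
  have "(2::real) powi i \<le> (2 powi i) ^ CARD('n)"
    using assms by (intro self_le_power) (simp_all add: one_le_power_int)
  moreover have "(\<integral>\<^sup>+y\<in>dcube i x. G y \<partial>lebesgue) \<le> (\<integral>\<^sup>+x. G x \<partial>lebesgue)"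
    by (intro nn_integral_mono) (auto simp: indicator_def)
  ultimately show ?thesis
    unfolding avg_def emeasure_dcube divide_ennreal_def
    by (intro mult_mono) (auto simp: inverse_ennreal intro!: ennreal_leI le_imp_inverse_le)
qed

text \<open>Averages of an integrable \<open>G\<close> over growing cubes tend to 0, so only
  finitely many cubes above \<open>Q\<close> exceed the threshold; the largest of them is a stopping
  cube.\<close>

lemma stopping_cubes_cover:
  fixes x :: "real^'n"
  assumes fin: "(\<integral>\<^sup>+x. G x \<partial>lebesgue) < \<infinity>"
    and Q: "Q \<in> dyadic_cubes" "x \<in> Q" "ennreal (stopping_ratio TYPE('n) powi k) < avg Q G"
  obtains R where "R \<in> stopping_cubes G k" "Q \<subseteq> R"
proof -
  define b where "b = stopping_ratio TYPE('n) powi k"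
  have b: "0 < b" using stopping_ratio_ge[where 'n='n] by (simp add: b_def)
  obtain I where I: "0 \<le> I" "(\<integral>\<^sup>+x. G x \<partial>lebesgue) = ennreal I"
    using fin by (cases "\<integral>\<^sup>+x. G x \<partial>lebesgue") auto
  obtain N where N: "I / b < 2 ^ N"
    using real_arch_pow[of 2 "I / b"] by auto
  obtain j where j: "Q = dcube j x" using dyadic_cubes_containing[OF Q(1,2)] by metis
  define P where "P = {i. j \<le> i \<and> ennreal b < avg (dcube i x) G}"
  have bound: "i \<le> int N" if "i \<in> P" for i
  proof (rule ccontr)
    assume "\<not> i \<le> int N"
    then have i: "int N \<le> i" by simp
    have "avg (dcube i x) G \<le> ennreal I / ennreal (2 powi i)"
      using avg_dcube_le_total[of i x G] i I(2) by simp
    also have "\<dots> = ennreal (I / 2 powi i)"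
      using I(1) by (simp add: divide_ennreal)
    also have "I / 2 powi i \<le> b"
    proof -
      have "(2::real) ^ N \<le> 2 powi i"
        using power_int_increasing[OF i, of "2::real"] by simp
      then have "I / b \<le> 2 powi i" using N by linarith
      then show ?thesis using b by (simp add: field_simps)
    qed
    then have "ennreal (I / 2 powi i) \<le> ennreal b" by (rule ennreal_leI)
    finally show False using that by (simp add: P_def not_le[symmetric])
  qed
  have "P \<subseteq> {j..int N}" using bound by (auto simp: P_def)
  then have finP: "finite P" by (rule finite_subset) simp
  have jP: "j \<in> P" using Q(3) by (simp add: P_def b_def j)
  have M: "Max P \<in> P" using finP jP Max_in by blast
  have up: "avg (dcube i x) G \<le> ennreal b" if "Max P < i" for i
  proof (rule ccontr)
    assume "\<not> ?thesis"
    then have "i \<in> P" using that M by (auto simp: P_def)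
    then show False using Max_ge[OF finP] that by fastforce
  qed
  show ?thesis
  proof
    show "dcube (Max P) x \<in> stopping_cubes G k"
      using M up unfolding stopping_cubes_def P_def b_def by blast
    show "Q \<subseteq> dcube (Max P) x"
      using dcube_mono[of j "Max P" x] M by (auto simp: j P_def)
  qed
qed

section \<open>Sparseness of the stopping cubes\<close>

lemma dcube_parent_measure:
  fixes x :: "real^'n"
  shows "emeasure lebesgue (dcube (j + 1) x) = ennreal (2 ^ CARD('n)) * emeasure lebesgue (dcube j x)"
  by (simp add: emeasure_dcube power_int_add power_mult_distrib ennreal_mult' mult.commute)

lemma set_nn_integral_eq_avg:
  assumes "Q \<in> dyadic_cubes"
  shows "(\<integral>\<^sup>+x\<in>Q. G x \<partial>lebesgue) = avg Q G * emeasure lebesgue Q"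
proof -
  obtain r where "0 < r" "emeasure lebesgue Q = ennreal r"
    using emeasure_dyadic_cube[OF assms] .
  then show ?thesis
    by (simp add: avg_def ennreal_divide_times mult_divide_eq_ennreal)
qed

text \<open>Write \<open>a\<close> for the stopping ratio. The average over the parent is at most
  the threshold \<open>a ^ k\<close>, and the parent has \<open>2 ^ n = a / 2\<close> times the
  volume of \<open>Q\<close>.\<close>

lemma stopping_cubes_integral_le:
  fixes G :: "real^'n \<Rightarrow> ennreal"
  assumes "Q \<in> stopping_cubes G k"
  shows "(\<integral>\<^sup>+x\<in>Q. G x \<partial>lebesgue) \<le> ennreal (stopping_ratio TYPE('n) powi (k + 1) / 2) * emeasure lebesgue Q"
proof -
  obtain j x where Q: "Q = dcube j x" and
      *: "\<forall>i>j. avg (dcube i x) G \<le> ennreal (stopping_ratio TYPE('n) powi k)"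
    using assms by (auto simp: stopping_cubes_def)
  have "(\<integral>\<^sup>+x\<in>Q. G x \<partial>lebesgue) \<le> (\<integral>\<^sup>+y\<in>dcube (j+1) x. G y \<partial>lebesgue)"
    using dcube_mono_step[of j x] unfolding Q
    by (intro nn_integral_mono) (auto simp: indicator_def)
  also have "\<dots> = avg (dcube (j+1) x) G * emeasure lebesgue (dcube (j+1) x)"
    by (simp add: set_nn_integral_eq_avg)
  also have "\<dots> \<le> ennreal (stopping_ratio TYPE('n) powi k) * emeasure lebesgue (dcube (j+1) x)"
    using * by (intro mult_right_mono) auto
  also have "\<dots> = ennreal (stopping_ratio TYPE('n) powi k * 2 ^ CARD('n)) * emeasure lebesgue Q"
    using stopping_ratio_ge[where 'n='n] unfolding dcube_parent_measure Q
    by (subst ennreal_mult) (auto simp: mult.assoc)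
  also have "stopping_ratio TYPE('n) powi k * 2 ^ CARD('n) = stopping_ratio TYPE('n) powi (k + 1) / 2"
    using stopping_ratio_ge[where 'n='n] by (simp add: power_int_add) (simp add: stopping_ratio_def)
  finally show ?thesis .
qed

text \<open>For integrable \<open>G\<close> this is the level set where the dyadic maximal function
  of \<open>G\<close> exceeds the \<open>k\<close>-th power of the stopping ratio.\<close>

definition stopping_union :: "(real^'n \<Rightarrow> ennreal) \<Rightarrow> int \<Rightarrow> (real^'n) set" where
  "stopping_union G k = \<Union>(stopping_cubes G k)"

lemma countable_stopping_cubes: "countable (stopping_cubes G k)"
  using countable_subset[OF _ countable_dyadic_cubes] stopping_cubes_dyadic by blast

lemma stopping_union_measurable [measurable]: "stopping_union G k \<in> sets lebesgue"
  unfolding stopping_union_def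
  by (intro sets.countable_Union countable_stopping_cubes)
     (auto dest: stopping_cubes_dyadic dyadic_cube_measurable)

lemma stopping_union_antimono:
  fixes G :: "real^'n \<Rightarrow> ennreal"
  assumes fin: "(\<integral>\<^sup>+x. G x \<partial>lebesgue) < \<infinity>" and "k \<le> l"
  shows "stopping_union G l \<subseteq> stopping_union G k"
proof
  fix z assume "z \<in> stopping_union G l"
  then obtain Q where Q: "Q \<in> stopping_cubes G l" "z \<in> Q" by (auto simp: stopping_union_def)
  have "stopping_ratio TYPE('n) powi k \<le> stopping_ratio TYPE('n) powi l"
    using stopping_ratio_ge[where 'n='n] assms(2) by (intro power_int_increasing) auto
  then have "ennreal (stopping_ratio TYPE('n) powi k) < avg Q G"
    using stopping_cubes_avg[OF Q(1)] ennreal_leI order.strict_trans1 by blast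
  then show "z \<in> stopping_union G k"
    using stopping_cubes_cover[OF fin stopping_cubes_dyadic[OF Q(1)] Q(2)] Q(2)
    unfolding stopping_union_def by blast
qed

text \<open>At a common point the average at the scale of \<open>R\<close> exceeds the
  \<open>k\<close>-th threshold as well, and no scale above that of \<open>Q\<close> has this
  property.\<close>

lemma stopping_cubes_subset:
  fixes G :: "real^'n \<Rightarrow> ennreal"
  assumes "Q \<in> stopping_cubes G k" "R \<in> stopping_cubes G l" "k \<le> l" "Q \<inter> R \<noteq> {}"
  shows "R \<subseteq> Q"
proof -
  obtain z where z: "z \<in> Q" "z \<in> R" using assms(4) by auto
  obtain i where i: "Q = dcube i z"
    "\<And>m. i < m \<Longrightarrow> avg (dcube m z) G \<le> ennreal (stopping_ratio TYPE('n) powi k)"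
    using stopping_cubes_containing[OF assms(1) z(1)] by metis
  obtain j where j: "R = dcube j z" "ennreal (stopping_ratio TYPE('n) powi l) < avg (dcube j z) G"
    using stopping_cubes_containing[OF assms(2) z(2)] by metis
  have "stopping_ratio TYPE('n) powi k \<le> stopping_ratio TYPE('n) powi l"
    using stopping_ratio_ge[where 'n='n] assms(3) by (intro power_int_increasing) auto
  then have "j \<le> i" using i(2)[of j] j(2) by (meson ennreal_leI leD le_less_trans not_le)
  then show ?thesis using dcube_mono i(1) j(1) by blast
qed

text \<open>The stopping cubes of level \<open>k + 1\<close> meeting \<open>Q\<close> are disjoint
  subcubes of \<open>Q\<close> on which \<open>G\<close> averages more than
  \<open>b = a ^ (k + 1)\<close>. Their union has measure at most \<open>G(Q) / b\<close>, and
  \<open>stopping_cubes_integral_le\<close> makes this at most half of \<open>Q\<close>.\<close>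

lemma stopping_cubes_sparse:
  fixes G :: "real^'n \<Rightarrow> ennreal"
  assumes G: "G \<in> borel_measurable lebesgue"
    and Q: "Q \<in> stopping_cubes G k"
  shows "emeasure lebesgue Q \<le> 2 * emeasure lebesgue (Q - stopping_union G (k + 1))"
proof -
  define b where "b = stopping_ratio TYPE('n) powi (k + 1)"
  have b: "0 < b" using stopping_ratio_ge[where 'n='n] by (simp add: b_def)
  obtain q where q: "0 < q" "emeasure lebesgue Q = ennreal q"
    using emeasure_dyadic_cube[OF stopping_cubes_dyadic[OF Q]] .
  define F where "F = {R \<in> stopping_cubes G (k + 1). R \<inter> Q \<noteq> {}}"
  have sub: "R \<subseteq> Q" if "R \<in> F" for R
    using that stopping_cubes_subset[OF Q, of R "k+1"] by (auto simp: F_def)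
  have cF: "countable F"
    by (rule countable_subset[OF _ countable_stopping_cubes[of G "k+1"]]) (auto simp: F_def)
  have mF: "R \<in> sets lebesgue" if "R \<in> F" for R
    using that by (auto simp: F_def dest: stopping_cubes_dyadic dyadic_cube_measurable)
  have dF: "disjoint_family_on (\<lambda>R. R) F"
    unfolding disjoint_family_on_def F_def using stopping_cubes_disjoint by blast
  have mQ: "Q \<in> sets lebesgue" using Q by (auto dest: stopping_cubes_dyadic dyadic_cube_measurable)
  have un: "Q \<inter> stopping_union G (k + 1) = (\<Union>R\<in>F. R)"
    using sub by (auto simp: stopping_union_def F_def)
  have "ennreal b * emeasure lebesgue (\<Union>R\<in>F. R) = (\<integral>\<^sup>+R. ennreal b * emeasure lebesgue R \<partial>count_space F)"
    using emeasure_UN_countable[OF _ cF dF, of lebesgue] mF by (simp add: nn_integral_cmult)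
  also have "\<dots> \<le> (\<integral>\<^sup>+R. emeasure (density lebesgue G) R \<partial>count_space F)"
  proof (rule nn_integral_mono)
    fix R assume "R \<in> space (count_space F)"
    then have R: "R \<in> F" by simp
    then have "R \<in> stopping_cubes G (k + 1)" by (simp add: F_def)
    then have "ennreal b * emeasure lebesgue R \<le> avg R G * emeasure lebesgue R"
      using stopping_cubes_avg[of R G "k+1"] unfolding b_def by (intro mult_right_mono) auto
    also have "\<dots> = emeasure (density lebesgue G) R"
      using set_nn_integral_eq_avg[of R G] stopping_cubes_dyadic \<open>R \<in> stopping_cubes G (k + 1)\<close>
        emeasure_density[OF G mF[OF R]] by metis
    finally show "ennreal b * emeasure lebesgue R \<le> emeasure (density lebesgue G) R" .
  qed
  also have "\<dots> = emeasure (density lebesgue G) (\<Union>R\<in>F. R)"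
    using emeasure_UN_countable[OF _ cF dF, of "density lebesgue G"] mF by simp
  also have "\<dots> \<le> emeasure (density lebesgue G) Q"
    using sub mQ by (intro emeasure_mono) auto
  also have "\<dots> \<le> ennreal (b / 2) * ennreal q"
    using stopping_cubes_integral_le[OF Q] emeasure_density[OF G mQ] by (simp add: b_def q(2))
  finally have 1: "ennreal b * emeasure lebesgue (Q \<inter> stopping_union G (k + 1)) \<le> ennreal (b / 2) * ennreal q"
    by (simp add: un)
  have "emeasure lebesgue (Q \<inter> stopping_union G (k + 1)) \<le> emeasure lebesgue Q"
    using mQ by (intro emeasure_mono) auto
  then obtain r where r: "0 \<le> r" "emeasure lebesgue (Q \<inter> stopping_union G (k + 1)) = ennreal r"
    unfolding q(2) by (cases "emeasure lebesgue (Q \<inter> stopping_union G (k + 1))") (auto simp: top_unique)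
  have "b * r \<le> b / 2 * q"
    using 1 b q(1) r(1) unfolding r(2) by (simp add: ennreal_mult''[symmetric])
  then have rq: "2 * r \<le> q" using b by (simp add: field_simps)
  have "emeasure lebesgue (Q - stopping_union G (k + 1)) = emeasure lebesgue (Q - (Q \<inter> stopping_union G (k + 1)))"
    by (rule arg_cong[where f="emeasure lebesgue"]) auto
  also have "\<dots> = ennreal q - ennreal r"
    using mQ r(2) q(2) by (subst emeasure_Diff) auto
  also have "\<dots> = ennreal (q - r)" using r(1) by (rule ennreal_minus)
  finally have "2 * emeasure lebesgue (Q - stopping_union G (k + 1)) = ennreal (2 * (q - r))"
    using r(1) rq by (subst ennreal_mult) auto
  then show ?thesis using rq unfolding q(2) by (simp add: ennreal_leI)
qed

section \<open>Carleson packing\<close>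

text \<open>Integrability on compact sets gives measurability of the restrictions to balls, and
  \<open>w\<close> is their pointwise limit.\<close>

lemma weight_measurable:
  fixes w :: "real^'n \<Rightarrow> real"
  assumes "weight w"
  shows "w \<in> borel_measurable lebesgue"
proof (rule borel_measurable_LIMSEQ_real)
  fix x :: "real^'n"
  obtain N where N: "norm x \<le> real N" using real_arch_simple by blast
  have "\<forall>\<^sub>F n in sequentially. indicator (cball 0 (real n)) x * w x = w x"
    using eventually_ge_at_top[of N]
  proof eventually_elim
    case (elim n)
    then have "norm x \<le> real n" using N by (meson of_nat_mono order_trans)
    then show ?case by simp
  qed
  then show "(\<lambda>n. indicator (cball 0 (real n)) x * w x) \<longlonglongrightarrow> w x"
    by (rule tendsto_eventually)
next
  fix n :: nat
  have "w absolutely_integrable_on (cball 0 (real n))"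
    using assms by (simp add: weight_def)
  then have "(\<lambda>x. indicator (cball 0 (real n)) x *\<^sub>R w x) \<in> borel_measurable lebesgue"
    by (simp add: set_integrable_def borel_measurable_integrable)
  then show "(\<lambda>x. indicator (cball 0 (real n)) x * w x) \<in> borel_measurable lebesgue"
    by simp
qed

lemma weight_measurable_ennreal:
  "weight w \<Longrightarrow> (\<lambda>x. ennreal (w x)) \<in> borel_measurable lebesgue"
  using weight_measurable by measurable

lemma wmeas_density:
  assumes "weight w" "E \<in> sets lebesgue"
  shows "wmeas w E = emeasure (density lebesgue (\<lambda>x. ennreal (w x))) E"
  unfolding wmeas_def
  using emeasure_density[OF weight_measurable_ennreal[OF assms(1)] assms(2)] by simp

lemma wmeas_mono: "A \<subseteq> B \<Longrightarrow> wmeas w A \<le> wmeas w B"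
  unfolding wmeas_def by (intro nn_integral_mono) (auto simp: indicator_def)

lemma wmeas_compact_finite:
  assumes "weight w" "compact K"
  shows "wmeas w K < \<infinity>"
proof -
  have "integrable lebesgue (\<lambda>x. indicator K x *\<^sub>R w x)"
    using assms by (simp add: weight_def set_integrable_def)
  then have "(\<integral>\<^sup>+x. ennreal (norm (indicator K x *\<^sub>R w x)) \<partial>lebesgue) < \<infinity>"
    by (simp add: integrable_iff_bounded)
  moreover have "ennreal (norm (indicator K x *\<^sub>R w x)) = ennreal (w x) * indicator K x" for x
    using assms by (auto simp: weight_def indicator_def)
  ultimately show ?thesis by (simp add: wmeas_def)
qed

lemma wmeas_dyadic_finite:
  assumes "weight w" "Q \<in> dyadic_cubes"
  shows "wmeas w Q < \<infinity>"
proof -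
  obtain R where "Q \<subseteq> R" "compact R" using dyadic_cube_closure[OF assms(2)] by metis
  then have "wmeas w Q \<le> wmeas w R" "wmeas w R < \<infinity>"
    using wmeas_compact_finite[OF assms(1)] wmeas_mono by auto
  then show ?thesis by (rule order.strict_trans1)
qed

lemma wmeas_eq_avg:
  assumes "Q \<in> dyadic_cubes"
  shows "wmeas w Q = avg Q (\<lambda>x. ennreal (w x)) * emeasure lebesgue Q"
  using set_nn_integral_eq_avg[OF assms] by (simp add: wmeas_def)

text \<open>\<open>HL_maximal\<close> uses closed cubes, so \<open>Q\<close> is replaced by its
  closure \<open>S\<close> of equal measure. Truncating \<open>w\<close> to \<open>R\<close> loses
  nothing on \<open>Q\<close>.\<close>

lemma avg_le_HL_maximal:
  assumes w: "weight w" and Q: "Q \<in> dyadic_cubes" and "x \<in> Q" "Q \<subseteq> R"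
  shows "avg Q (\<lambda>x. ennreal (w x)) \<le> HL_maximal (\<lambda>y. indicator R y * w y) x"
proof -
  obtain S where S: "S \<in> cubes" "Q \<subseteq> S" "emeasure lebesgue S = emeasure lebesgue Q"
    using dyadic_cube_closure[OF Q] by metis
  have "ennreal (w y) * indicator Q y \<le> ennreal \<bar>indicator R y * w y\<bar> * indicator S y" for y
    using S(2) assms(4) w by (auto simp: indicator_def weight_def)
  then have "avg Q (\<lambda>x. ennreal (w x)) \<le> avg S (\<lambda>y. ennreal \<bar>indicator R y * w y\<bar>)"
    unfolding avg_def S(3) by (intro divide_right_mono_ennreal nn_integral_mono)
  also have "\<dots> \<le> HL_maximal (\<lambda>y. indicator R y * w y) x"
    unfolding HL_maximal_def maximal_op_def using S(1,2) assms(3) by (intro SUP_upper) auto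
  finally show ?thesis .
qed

lemma Ainf_const_bound:
  assumes w: "weight w" and R: "R \<in> cubes" "compact R" and pos: "wmeas w R \<noteq> 0"
  shows "(\<integral>\<^sup>+x\<in>R. HL_maximal (\<lambda>y. indicator R y * w y) x \<partial>lebesgue) \<le> Ainf_const w * wmeas w R"
proof -
  let ?I = "\<integral>\<^sup>+x\<in>R. HL_maximal (\<lambda>y. indicator R y * w y) x \<partial>lebesgue"
  have fin: "wmeas w R < \<infinity>" using wmeas_compact_finite[OF w R(2)] .
  have "?I / wmeas w R \<le> Ainf_const w"
    unfolding Ainf_const_def using R(1) by (rule SUP_upper)
  then have "?I / wmeas w R * wmeas w R \<le> Ainf_const w * wmeas w R"
    by (rule mult_right_mono) simp
  \<comment> \<open>The quotient can be multiplied out because \<open>wmeas w R\<close> is neither 0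
    nor infinite.\<close>
  moreover have "?I / wmeas w R * wmeas w R = ?I"
    using pos fin by (simp add: ennreal_divide_times mult_divide_eq_ennreal)
  ultimately show ?thesis by simp
qed

text \<open>\<open>wmeas w (Q i)\<close> is at most twice the integral over \<open>E i\<close> of
  the constant \<open>avg (Q i) w\<close>. That constant is below the maximal function of
  \<open>w\<close> cut off to \<open>R\<close>, the closure of \<open>P\<close>. As the
  \<open>E i\<close> are disjoint, the sum is at most twice one Fujii--Wilson integral.\<close>

lemma carleson_single:
  fixes w :: "real^'n \<Rightarrow> real"
  assumes w: "weight w" and F: "finite F"
    and Q: "\<And>i. i \<in> F \<Longrightarrow> Q i \<in> dyadic_cubes" "\<And>i. i \<in> F \<Longrightarrow> Q i \<subseteq> P"
    and P: "P \<in> dyadic_cubes"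
    and E: "\<And>i. i \<in> F \<Longrightarrow> E i \<in> sets lebesgue" "\<And>i. i \<in> F \<Longrightarrow> E i \<subseteq> Q i"
       "disjoint_family_on E F"
       "\<And>i. i \<in> F \<Longrightarrow> emeasure lebesgue (Q i) \<le> 2 * emeasure lebesgue (E i)"
  shows "(\<Sum>i\<in>F. wmeas w (Q i)) \<le> 2 * Ainf_const w * wmeas w P"
proof -
  obtain R where R: "R \<in> cubes" "P \<subseteq> R" "compact R"
    "\<And>g. (\<integral>\<^sup>+y\<in>R. g y \<partial>lebesgue) = (\<integral>\<^sup>+y\<in>P. g y \<partial>lebesgue)"
    using dyadic_cube_closure[OF P] by metis
  have RP: "wmeas w R = wmeas w P" using R(4) by (simp add: wmeas_def)
  have sub: "Q i \<subseteq> R" if "i \<in> F" for i using Q(2)[OF that] R(2) by auto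
  show ?thesis
  proof (cases "wmeas w R = 0")
    \<comment> \<open>\<open>Ainf_const_bound\<close> does not cover a \<open>w\<close>-null cube,
      but then every \<open>Q i\<close> is \<open>w\<close>-null too.\<close>
    case True
    then have "wmeas w (Q i) = 0" if "i \<in> F" for i
      using wmeas_mono[OF sub[OF that], of w] by simp
    then show ?thesis by simp
  next
    case False
    let ?M = "HL_maximal (\<lambda>y. indicator R y * w y)"
    have "(\<Sum>i\<in>F. wmeas w (Q i)) \<le> (\<Sum>i\<in>F. 2 * (avg (Q i) (\<lambda>x. ennreal (w x)) * emeasure lebesgue (E i)))"
    proof (rule sum_mono)
      fix i assume i: "i \<in> F"
      have "wmeas w (Q i) \<le> avg (Q i) (\<lambda>x. ennreal (w x)) * (2 * emeasure lebesgue (E i))"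
        unfolding wmeas_eq_avg[OF Q(1)[OF i]] using E(4)[OF i] by (rule mult_left_mono) simp
      then show "wmeas w (Q i) \<le> 2 * (avg (Q i) (\<lambda>x. ennreal (w x)) * emeasure lebesgue (E i))"
        by (simp add: ac_simps)
    qed
    also have "\<dots> = 2 * (\<Sum>i\<in>F. \<integral>\<^sup>+x. avg (Q i) (\<lambda>x. ennreal (w x)) * indicator (E i) x \<partial>lebesgue)"
      unfolding sum_distrib_left using E(1) by (intro sum.cong) (auto simp: nn_integral_cmult_indicator)
    also have "\<dots> = 2 * (\<integral>\<^sup>+x. (\<Sum>i\<in>F. avg (Q i) (\<lambda>x. ennreal (w x)) * indicator (E i) x) \<partial>lebesgue)"
      using E(1) by (subst nn_integral_sum) auto
    also have "\<dots> \<le> 2 * (\<integral>\<^sup>+x\<in>R. ?M x \<partial>lebesgue)"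
    proof (intro mult_left_mono nn_integral_mono)
      fix x :: "real^'n"
      show "(\<Sum>i\<in>F. avg (Q i) (\<lambda>x. ennreal (w x)) * indicator (E i) x) \<le> ?M x * indicator R x"
      proof (cases "\<exists>i\<in>F. x \<in> E i")
        case True
        then obtain i where i: "i \<in> F" "x \<in> E i" by auto
        \<comment> \<open>By disjointness only one term of the sum survives at
          \<open>x\<close>.\<close>
        have "x \<notin> E j" if "j \<in> F - {i}" for j
          using disjoint_family_onD[OF E(3), of i j] i that by auto
        then have "(\<Sum>i\<in>F. avg (Q i) (\<lambda>x. ennreal (w x)) * indicator (E i) x) = avg (Q i) (\<lambda>x. ennreal (w x))"
          using F i by (subst sum.remove[of F i]) auto
        also have "\<dots> \<le> ?M x"
          using avg_le_HL_maximal[OF w Q(1)[OF i(1)] _ sub[OF i(1)], of x] E(2)[OF i(1)] i(2) by auto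
        also have "\<dots> = ?M x * indicator R x"
          using E(2)[OF i(1)] i(2) sub[OF i(1)] by auto
        finally show ?thesis .
      qed simp
    qed simp
    also have "\<dots> \<le> 2 * (Ainf_const w * wmeas w R)"
      using Ainf_const_bound[OF w R(1,3) False] by (rule mult_left_mono) simp
    finally show ?thesis by (simp add: RP mult.assoc)
  qed
qed

text \<open>Finiteness of the family guarantees that every cube lies in a maximal one.\<close>

lemma carleson_packing:
  fixes w :: "real^'n \<Rightarrow> real"
  assumes w: "weight w" and F: "finite F"
    and Q: "\<And>i. i \<in> F \<Longrightarrow> Q i \<in> dyadic_cubes"
    and E: "\<And>i. i \<in> F \<Longrightarrow> E i \<in> sets lebesgue" "\<And>i. i \<in> F \<Longrightarrow> E i \<subseteq> Q i"
       "disjoint_family_on E F"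
       "\<And>i. i \<in> F \<Longrightarrow> emeasure lebesgue (Q i) \<le> 2 * emeasure lebesgue (E i)"
    and G: "G \<in> borel_measurable lebesgue"
    and GQ: "\<And>i. i \<in> F \<Longrightarrow> c * wmeas w (Q i) \<le> (\<integral>\<^sup>+x\<in>Q i. G x \<partial>lebesgue)"
  shows "c * (\<Sum>i\<in>F. wmeas w (Q i)) \<le> 2 * Ainf_const w * (\<integral>\<^sup>+x. G x \<partial>lebesgue)"
proof -
  \<comment> \<open>The maximal cubes of the family. Nestedness makes them disjoint, and each
    \<open>Q i\<close> will be assigned to a maximal cube \<open>t i\<close> containing it.\<close>
  define T where "T = {P \<in> Q ` F. \<forall>R \<in> Q ` F. P \<subseteq> R \<longrightarrow> R = P}"
  have finT: "finite T" using F by (simp add: T_def)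
  have Tdy: "P \<in> dyadic_cubes" if "P \<in> T" for P using that Q by (auto simp: T_def)
  have disT: "disjoint_family_on (\<lambda>P. P) T"
    unfolding disjoint_family_on_def
  proof (intro ballI impI, rule ccontr)
    fix P R assume "P \<in> T" "R \<in> T" "P \<noteq> R" "P \<inter> R \<noteq> {}"
    then show False using dyadic_cubes_nested[of P R] Tdy unfolding T_def by blast
  qed
  have ex: "\<exists>P\<in>T. Q i \<subseteq> P" if "i \<in> F" for i
  proof -
    have "Q i \<in> Q ` F" using that by simp
    then obtain P where P: "P \<in> Q ` F" "Q i \<le> P" "\<forall>R\<in>Q ` F. P \<le> R \<longrightarrow> P = R"
      using finite_has_maximal2[of "Q ` F" "Q i"] F by blast
    then have "P \<in> T" by (simp add: T_def eq_commute[of _ P])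
    with P(2) show ?thesis by blast
  qed
  then obtain t where t: "\<And>i. i \<in> F \<Longrightarrow> t i \<in> T" "\<And>i. i \<in> F \<Longrightarrow> Q i \<subseteq> t i" by metis
  have "(\<Sum>i\<in>F. wmeas w (Q i)) = (\<Sum>P\<in>T. \<Sum>i | i \<in> F \<and> t i = P. wmeas w (Q i))"
    by (rule sum.group[symmetric]) (use F finT t(1) in blast)+
  also have "\<dots> \<le> (\<Sum>P\<in>T. 2 * Ainf_const w * wmeas w P)"
  proof (rule sum_mono)
    fix P assume P: "P \<in> T"
    have dis: "disjoint_family_on E {i \<in> F. t i = P}"
      using E(3) by (rule disjoint_family_on_mono[rotated]) auto
    show "(\<Sum>i | i \<in> F \<and> t i = P. wmeas w (Q i)) \<le> 2 * Ainf_const w * wmeas w P"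
    proof (rule carleson_single[OF w, where E=E, OF _ _ _ Tdy[OF P] _ _ dis])
      show "finite {i \<in> F. t i = P}" using F by simp
    next
      fix i assume "i \<in> {i \<in> F. t i = P}"
      then have i: "i \<in> F" "t i = P" by simp_all
      show "Q i \<in> dyadic_cubes" "Q i \<subseteq> P" "E i \<in> sets lebesgue" "E i \<subseteq> Q i"
        "emeasure lebesgue (Q i) \<le> 2 * emeasure lebesgue (E i)"
        using Q[OF i(1)] t(2)[OF i(1)] i(2) E(1,2,4)[OF i(1)] by (rule | simp)+
    qed
  qed
  finally have "c * (\<Sum>i\<in>F. wmeas w (Q i)) \<le> c * (\<Sum>P\<in>T. 2 * Ainf_const w * wmeas w P)"
    by (rule mult_left_mono) simp
  also have "\<dots> = 2 * Ainf_const w * (\<Sum>P\<in>T. c * wmeas w P)"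
    by (simp add: sum_distrib_left ac_simps)
  also have "\<dots> \<le> 2 * Ainf_const w * (\<integral>\<^sup>+x. G x \<partial>lebesgue)"
  proof (rule mult_left_mono)
    \<comment> \<open>The lower bound on the \<open>G\<close>-mass enters here, for the maximal
      cubes; being disjoint, these have total \<open>G\<close>-mass at most the whole
      integral.\<close>
    have "(\<Sum>P\<in>T. c * wmeas w P) \<le> (\<Sum>P\<in>T. emeasure (density lebesgue G) P)"
    proof (rule sum_mono)
      fix P assume P: "P \<in> T"
      then obtain i where "i \<in> F" "P = Q i" by (auto simp: T_def)
      then show "c * wmeas w P \<le> emeasure (density lebesgue G) P"
        using GQ emeasure_density[OF G dyadic_cube_measurable[OF Tdy[OF P]]] by simp
    qed
    also have "\<dots> = emeasure (density lebesgue G) (\<Union>P\<in>T. P)"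
      using finT disT Tdy by (intro sum_emeasure) (auto dest: dyadic_cube_measurable)
    also have "\<dots> \<le> emeasure (density lebesgue G) UNIV"
      using finT Tdy by (intro emeasure_mono) auto
    also have "\<dots> = (\<integral>\<^sup>+x. G x \<partial>lebesgue)"
      using emeasure_density[OF G, of UNIV] by simp
    finally show "(\<Sum>P\<in>T. c * wmeas w P) \<le> (\<integral>\<^sup>+x. G x \<partial>lebesgue)" .
  qed simp
  finally show ?thesis .
qed

section \<open>Sublevel sets of weights\<close>

lemma ennreal_mult_divide_le: "c * q / q \<le> (c :: ennreal)"
  by (cases "q = 0"; cases "q = top") (auto simp: mult_divide_eq_ennreal)

lemma inverse_ennreal_antimono: "x \<le> y \<Longrightarrow> inverse y \<le> inverse (x :: ennreal)"
  by (cases x; cases y; cases "x = 0")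
     (auto simp: inverse_ennreal ennreal_leI le_imp_inverse_le top_unique)

lemma ennreal_rpow_minus_one: "0 \<le> y \<Longrightarrow> ennreal_rpow (ennreal y) (- 1) = inverse (ennreal y)"
  by (cases "y = 0") (auto simp: ennreal_rpow_def inverse_ennreal powr_minus)

lemma ennreal_rpow_one: "ennreal_rpow x 1 = x"
  by (cases x) (auto simp: ennreal_rpow_def)

text \<open>The essential infimum is a supremum over possibly uncountably many lower bounds. A
  sequence among them already attains it, so only countably many null sets have to be
  united.\<close>

lemma AE_ess_inf_on_le:
  "AE x in lebesgue. x \<in> Q \<longrightarrow> ess_inf_on Q w \<le> ennreal (w x)"
proof -
  define A where "A = {c. AE x in lebesgue. x \<in> Q \<longrightarrow> c \<le> ennreal (w x)}"
  have "A \<noteq> {}" by (auto simp: A_def intro!: exI[of _ 0])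
  then obtain f :: "nat \<Rightarrow> ennreal" where f: "range f \<subseteq> A" "Sup A = (SUP i. f i)"
    using ennreal_Sup_countable_SUP by blast
  have "AE x in lebesgue. x \<in> Q \<longrightarrow> f i \<le> ennreal (w x)" for i
    using f(1) by (auto simp: A_def)
  then have "AE x in lebesgue. \<forall>i. x \<in> Q \<longrightarrow> f i \<le> ennreal (w x)"
    unfolding AE_all_countable by blast
  then show ?thesis
    unfolding ess_inf_on_def A_def[symmetric] f(2)
    by eventually_elim (auto intro: SUP_least)
qed

text \<open>For \<open>p = 2\<close> the dual exponent \<open>1 - p'\<close> is -1, and almost
  everywhere on \<open>Q\<close> the reciprocal of \<open>w\<close> is at most that of the essential
  infimum.\<close>

lemma Ap_const_2_le_A1:
  assumes "weight w"
  shows "Ap_const 2 w \<le> Ap_const 1 w"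
proof -
  have *: "avg Q (\<lambda>x. ennreal_rpow (ennreal (w x)) (- 1)) \<le> inverse (ess_inf_on Q w)" if "Q \<in> cubes" for Q
  proof -
    have mQ: "Q \<in> sets lebesgue" using that by (auto simp: cubes_def)
    have "(\<integral>\<^sup>+x\<in>Q. ennreal_rpow (ennreal (w x)) (- 1) \<partial>lebesgue) \<le> (\<integral>\<^sup>+x\<in>Q. inverse (ess_inf_on Q w) \<partial>lebesgue)"
    proof (rule nn_integral_mono_AE)
      show "AE x in lebesgue. ennreal_rpow (ennreal (w x)) (- 1) * indicator Q x
          \<le> inverse (ess_inf_on Q w) * indicator Q x"
        using AE_ess_inf_on_le[of Q w]
        by eventually_elim
           (use assms in \<open>auto simp: indicator_def ennreal_rpow_minus_one weight_def inverse_ennreal_antimono\<close>)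
    qed
    also have "\<dots> = inverse (ess_inf_on Q w) * emeasure lebesgue Q"
      using mQ by (rule nn_integral_cmult_indicator)
    finally have "avg Q (\<lambda>x. ennreal_rpow (ennreal (w x)) (- 1)) \<le>
        inverse (ess_inf_on Q w) * emeasure lebesgue Q / emeasure lebesgue Q"
      unfolding avg_def by (rule divide_right_mono_ennreal)
    also have "\<dots> \<le> inverse (ess_inf_on Q w)" by (rule ennreal_mult_divide_le)
    finally show ?thesis .
  qed
  have "Ap_const 2 w = (SUP Q \<in> cubes. avg Q (\<lambda>x. ennreal (w x)) *
         avg Q (\<lambda>x. ennreal_rpow (ennreal (w x)) (- 1)))"
    by (simp add: Ap_const_def ennreal_rpow_one)
  also have "\<dots> \<le> Ap_const 1 w"
    unfolding Ap_const_def A1_const_def if_P[OF refl]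
    by (rule SUP_mono) (use * in \<open>auto intro!: bexI mult_left_mono\<close>)
  finally show ?thesis .
qed

text \<open>Below \<open>N\<close>, which is about \<open>ln K\<close>, each term is bounded by 1.
  From \<open>N\<close> on the powers of \<open>a\<close> have absorbed \<open>K * a^2\<close>, and
  the terms are dominated by a geometric series of ratio \<open>x = a powr (- 1 / (p - 1))\<close>,
  whose sum is at most \<open>p\<close>.\<close>

lemma sum_min_geometric:
  fixes K a p :: real
  assumes p: "1 < p" and K: "1 \<le> K" and a: "4 \<le> a" and M: "finite M"
  shows "(\<Sum>m\<in>M. min 1 ((K * (a^2 / a^m)) powr (1 / (p - 1)))) \<le> 5 * max p (ln K)"
proof -
  define e where "e = 1 / (p - 1)"
  define \<tau> where "\<tau> m = min 1 ((K * (a^2 / a^m)) powr e)" for m :: nat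
  define N where "N = nat \<lceil>ln K\<rceil> + 2"
  define x where "x = a powr (- e)"
  have e: "0 < e" using p by (simp add: e_def)
  \<comment> \<open>The bound \<open>4 \<le> a\<close> enters through \<open>exp 1 < a\<close>, both
    here and in \<open>KN\<close>.\<close>
  have "1 < ln a"
  proof -
    have "exp 1 < (4::real)" using e_less_272 by linarith
    then have "exp 1 < a" using a by linarith
    then have "ln (exp 1) < ln a" using a by (subst ln_less_cancel_iff) auto
    then show ?thesis by simp
  qed
  define y where "y = e * ln a"
  have y: "e \<le> y" "0 < y" using e \<open>1 < ln a\<close> by (auto simp: y_def)
  have xy: "x = exp (- y)" using a by (simp add: x_def y_def powr_def)
  then have x01: "0 < x" "x < 1" using y by auto
  \<comment> \<open>With \<open>x = exp (- y)\<close> and \<open>1 + y \<le> exp y\<close>, the sum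
    \<open>1 / (1 - x)\<close> is at most \<open>1 + 1 / y \<le> 1 + 1 / e = p\<close>.\<close>
  have inv: "1 / (1 - x) \<le> p"
  proof -
    have "1 + y \<le> exp y" by (rule exp_ge_add_one_self)
    then have "x \<le> 1 / (1 + y)" using y(2) by (simp add: xy exp_minus field_simps)
    then have "y / (1 + y) \<le> 1 - x" using y(2) by (simp add: field_simps)
    then have "1 / (1 - x) \<le> (1 + y) / y" using y(2) x01 by (simp add: field_simps)
    also have "\<dots> = 1 + 1 / y" using y(2) by (simp add: field_simps)
    also have "\<dots> \<le> 1 + 1 / e" using y(1) e by (simp add: frac_le)
    also have "\<dots> = p" by (simp add: e_def)
    finally show ?thesis .
  qed
  have KN: "K * a^2 \<le> a ^ N"
  proof -
    have "K = exp (ln K)" using K by simp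
    also have "\<dots> \<le> exp (real (nat \<lceil>ln K\<rceil>))" by (simp add: real_nat_ceiling_ge)
    also have "\<dots> = exp 1 ^ nat \<lceil>ln K\<rceil>" by (metis exp_of_nat_mult mult.right_neutral)
    also have "\<dots> \<le> a ^ nat \<lceil>ln K\<rceil>"
      using e_less_272 a by (intro power_mono) auto
    finally have "K * a^2 \<le> a ^ nat \<lceil>ln K\<rceil> * a^2" by (rule mult_right_mono) simp
    then show ?thesis unfolding N_def power_add .
  qed
  have tail: "\<tau> m \<le> x ^ (m - N)" if "N \<le> m" for m
  proof -
    have "a ^ m = a ^ N * a ^ (m - N)" using that by (simp add: power_add[symmetric])
    then have "K * (a^2 / a^m) \<le> 1 / a ^ (m - N)"
      using KN a by (simp add: field_simps)
    then have "(K * (a^2 / a^m)) powr e \<le> (1 / a ^ (m - N)) powr e"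
      using e K a by (intro powr_mono2) auto
    also have "1 / a ^ (m - N) = a powr (- real (m - N))"
      using a by (simp add: powr_minus_divide powr_realpow)
    also have "\<dots> powr e = x powr real (m - N)"
      by (simp add: x_def powr_powr mult.commute)
    also have "\<dots> = x ^ (m - N)"
      using x01 by (simp add: powr_realpow)
    finally show ?thesis by (simp add: \<tau>_def)
  qed
  have "(\<Sum>m\<in>M. \<tau> m) = (\<Sum>m\<in>M \<inter> {..<N}. \<tau> m) + (\<Sum>m\<in>M - {..<N}. \<tau> m)"
    using M by (rule sum.Int_Diff)
  also have "(\<Sum>m\<in>M \<inter> {..<N}. \<tau> m) \<le> real N"
  proof -
    have "(\<Sum>m\<in>M \<inter> {..<N}. \<tau> m) \<le> (\<Sum>m\<in>M \<inter> {..<N}. 1)" by (intro sum_mono) (simp add: \<tau>_def)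
    also have "\<dots> = real (card (M \<inter> {..<N}))" by simp
    also have "card (M \<inter> {..<N}) \<le> card {..<N}" by (intro card_mono) auto
    finally show ?thesis by simp
  qed
  also have "(\<Sum>m\<in>M - {..<N}. \<tau> m) \<le> (\<Sum>m\<in>M - {..<N}. x ^ (m - N))"
    using tail by (intro sum_mono) auto
  also have "\<dots> = (\<Sum>i\<in>(\<lambda>m. m - N) ` (M - {..<N}). x ^ i)"
    by (subst sum.reindex) (auto simp: inj_on_def)
  also have "\<dots> \<le> (\<Sum>i. x ^ i)"
    using x01 M by (intro sum_le_suminf summable_geometric) auto
  also have "\<dots> = 1 / (1 - x)" using x01 by (intro suminf_geometric) auto
  also have "\<dots> \<le> p" by (rule inv)
  finally have "(\<Sum>m\<in>M. \<tau> m) \<le> real N + p" by simp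
  \<comment> \<open>Rounding up costs 1 and the factor \<open>a^2\<close> costs 2; the resulting 3
    is at most \<open>3 * p\<close>.\<close>
  also have "real N \<le> ln K + 3"
    using K by (simp add: N_def) linarith
  finally show ?thesis using p K unfolding \<tau>_def e_def by simp
qed

text \<open>On the sublevel set \<open>B\<close> the weight is at most \<open>L\<close>, so the
  \<open>w\<close>-mass of \<open>B\<close> is at most \<open>L\<close> times its measure. The dual
  weight \<open>w powr (- 1 / (p - 1))\<close> is large on \<open>B\<close>, so the
  \<open>A_p\<close> condition bounds the proportion of \<open>B\<close> in \<open>Q\<close>. The 1
  in the minimum is the trivial bound on that proportion.\<close>

lemma wmeas_sublevel_le:
  fixes w :: "real^'n \<Rightarrow> real"
  assumes w: "weight w" and p: "1 < p" and Ap: "Ap_const p w \<le> ennreal K" and K: "0 < K" and s: "0 < s"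
    and Q: "Q \<in> dyadic_cubes"
    and q: "emeasure lebesgue Q = ennreal q" "0 < q" and \<nu>: "wmeas w Q = ennreal \<nu>" "0 \<le> \<nu>"
  shows "wmeas w {x \<in> Q. w x \<le> s * \<nu> / q} \<le> ennreal (s * min 1 ((K * s) powr (1 / (p - 1))) * \<nu>)"
proof (cases "\<nu> = 0")
  case True
  have "wmeas w {x \<in> Q. w x \<le> s * \<nu> / q} \<le> wmeas w Q" by (rule wmeas_mono) auto
  then show ?thesis using True \<nu>(1) by simp
next
  case False
  then have \<nu>0: "0 < \<nu>" using \<nu>(2) by simp
  define L where "L = s * \<nu> / q"
  have L: "0 < L" using s \<nu>0 q(2) by (simp add: L_def)
  define B where "B = {x \<in> Q. w x \<le> L}"
  define e where "e = 1 / (p - 1)"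
  have e: "0 < e" using p by (simp add: e_def)
  have w0: "0 \<le> w x" for x using w by (simp add: weight_def)
  have mB: "B \<in> sets lebesgue"
  proof -
    have "{x \<in> space lebesgue. w x \<le> L} \<in> sets lebesgue"
      using weight_measurable[OF w] by measurable
    moreover have "B = Q \<inter> {x \<in> space lebesgue. w x \<le> L}" by (auto simp: B_def)
    ultimately show ?thesis using dyadic_cube_measurable[OF Q] by simp
  qed
  have "emeasure lebesgue B \<le> ennreal q"
    unfolding q(1)[symmetric] using dyadic_cube_measurable[OF Q] by (intro emeasure_mono) (auto simp: B_def)
  then obtain b where b: "emeasure lebesgue B = ennreal b" "0 \<le> b" "b \<le> q"
    using q(2) by (cases "emeasure lebesgue B") (auto simp: top_unique)
  have "wmeas w B \<le> (\<integral>\<^sup>+x\<in>B. ennreal L \<partial>lebesgue)"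
    unfolding wmeas_def by (intro nn_integral_mono) (auto simp: B_def indicator_def ennreal_leI)
  also have "\<dots> = ennreal (L * b)"
    unfolding nn_integral_cmult_indicator[OF mB] b(1) using b(2) by (rule ennreal_mult''[symmetric])
  also have "L * b = s * (b / q) * \<nu>" by (simp add: L_def)
  finally have 1: "wmeas w B \<le> ennreal (s * (b / q) * \<nu>)" .
  have 2: "b / q \<le> (K * s) powr e"
  proof (cases "b = 0")
    case False
    then have b0: "0 < b" using b(2) by simp
    obtain R where R: "R \<in> cubes" "Q \<subseteq> R" "compact R" "emeasure lebesgue R = emeasure lebesgue Q"
      "\<And>g. (\<integral>\<^sup>+y\<in>R. g y \<partial>lebesgue) = (\<integral>\<^sup>+y\<in>Q. g y \<partial>lebesgue)"
      by (rule dyadic_cube_closure[OF Q], rule that, assumption+)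
    have p': "1 - p / (p - 1) = - e" using p by (simp add: e_def field_simps)
    let ?h = "\<lambda>x. ennreal_rpow (ennreal (w x)) (- e)"
    \<comment> \<open>A lower bound for the mean of the dual weight, obtained from \<open>B\<close>
      alone with \<open>w\<close> replaced by \<open>L\<close>.\<close>
    define y where "y = L powr (- e) * (b / q)"
    have y0: "0 < y" using L b0 q(2) by (simp add: y_def)
    have "ennreal (L powr (- e) * b) = (\<integral>\<^sup>+x\<in>B. ennreal (L powr (- e)) \<partial>lebesgue)"
      unfolding nn_integral_cmult_indicator[OF mB] b(1) using b(2) by (rule ennreal_mult'')
    also have "\<dots> \<le> (\<integral>\<^sup>+x\<in>R. ?h x \<partial>lebesgue)"
    proof (rule nn_integral_mono)
      fix x :: "real^'n"
      show "ennreal (L powr (- e)) * indicator B x \<le> ?h x * indicator R x"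
      proof (cases "x \<in> B")
        case True
        then have "w x \<le> L" "x \<in> R" using R(2) by (auto simp: B_def)
        \<comment> \<open>Where \<open>w\<close> vanishes, the right side is infinite by the
          convention for negative powers.\<close>
        moreover have "ennreal (L powr (- e)) \<le> ?h x"
        proof (cases "w x = 0")
          case False
          then have "L powr (- e) \<le> w x powr (- e)"
            using \<open>w x \<le> L\<close> w0[of x] e by (intro powr_mono2') auto
          then show ?thesis using False w0[of x] e by (simp add: ennreal_rpow_def ennreal_leI)
        qed (use e in \<open>simp add: ennreal_rpow_def\<close>)
        ultimately show ?thesis using True by simp
      qed simp
    qed
    finally have "ennreal (L powr (- e) * b) / ennreal q \<le> avg R ?h"
      unfolding avg_def R(4) q(1) by (rule divide_right_mono_ennreal)
    then have yh: "ennreal y \<le> avg R ?h"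
      using q(2) b(2) by (simp add: divide_ennreal y_def)
    have "ennreal (y powr (p - 1)) \<le> ennreal_rpow (avg R ?h) (p - 1)"
    proof (cases "avg R ?h")
      case (real r)
      then have "y \<le> r" using yh y0 by simp
      then have "y powr (p - 1) \<le> r powr (p - 1)" using y0 p by (intro powr_mono2) auto
      then show ?thesis using real \<open>y \<le> r\<close> y0 p by (auto simp: ennreal_rpow_def ennreal_leI)
    qed (use p in \<open>simp add: ennreal_rpow_def\<close>)
    moreover have "avg R (\<lambda>x. ennreal (w x)) = ennreal (\<nu> / q)"
      using R(5)[of "\<lambda>x. ennreal (w x)"] \<nu> q by (simp add: avg_def R(4) wmeas_def divide_ennreal)
    ultimately have "ennreal (\<nu> / q) * ennreal (y powr (p - 1)) \<le>
        avg R (\<lambda>x. ennreal (w x)) * ennreal_rpow (avg R ?h) (p - 1)"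
      by (simp add: mult_left_mono)
    also have "\<dots> \<le> Ap_const p w"
    proof -
      have *: "Ap_const p w = (SUP Q \<in> cubes. avg Q (\<lambda>x. ennreal (w x)) *
          ennreal_rpow (avg Q (\<lambda>x. ennreal_rpow (ennreal (w x)) (- e))) (p - 1))"
        using p unfolding Ap_const_def Let_def p' by simp
      show ?thesis unfolding * using R(1) by (rule SUP_upper)
    qed
    also have "\<dots> \<le> ennreal K" by (rule Ap)
    finally have "\<nu> / q * y powr (p - 1) \<le> K"
      using K \<nu>0 q(2) by (simp add: ennreal_mult''[symmetric])
    \<comment> \<open>As \<open>e * (p - 1) = 1\<close>, the power of \<open>L\<close> becomes
      \<open>L powr (- 1)\<close>, and the factor \<open>\<nu> / q\<close> in \<open>L\<close> then
      cancels the mean of \<open>w\<close>.\<close>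
    moreover have "y powr (p - 1) = (b / q) powr (p - 1) / L"
    proof -
      have "y powr (p - 1) = (L powr (- e)) powr (p - 1) * (b / q) powr (p - 1)"
        unfolding y_def by (rule powr_mult)
      also have "(L powr (- e)) powr (p - 1) = L powr (- 1)"
        using p by (simp add: powr_powr e_def)
      finally show ?thesis using L by (simp add: powr_minus_divide)
    qed
    ultimately have "(b / q) powr (p - 1) \<le> K * s"
      using s \<nu>0 q(2) by (simp add: L_def field_simps)
    then have "((b / q) powr (p - 1)) powr e \<le> (K * s) powr e"
      using e by (intro powr_mono2) auto
    then show ?thesis using p b0 q(2) by (simp add: powr_powr e_def)
  qed simp
  have "s * (b / q) * \<nu> \<le> s * min 1 ((K * s) powr e) * \<nu>"
    using 2 b q(2) s \<nu>(2) by (intro mult_right_mono mult_left_mono) auto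
  then show ?thesis using 1 unfolding B_def L_def e_def by (meson ennreal_leI order_trans)
qed

section \<open>The weak type estimate\<close>

text \<open>The packing estimates concern finite families. The union is exhausted by increasing
  finite unions, so a bound uniform over finite subfamilies passes to the limit.\<close>

lemma wmeas_UN_le:
  fixes w :: "real^'n \<Rightarrow> real"
  assumes w: "weight w" and I: "countable I" and B: "\<And>i. i \<in> I \<Longrightarrow> B i \<in> sets lebesgue"
    and le: "\<And>F. finite F \<Longrightarrow> F \<subseteq> I \<Longrightarrow> (\<Sum>i\<in>F. wmeas w (B i)) \<le> C"
  shows "wmeas w (\<Union>i\<in>I. B i) \<le> C"
proof (cases "I = {}")
  case True
  then show ?thesis by (simp add: wmeas_def)
next
  case False
  let ?\<mu> = "density lebesgue (\<lambda>x. ennreal (w x))"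
  define U where "U n = (\<Union>i\<in>from_nat_into I ` {..n}. B i)" for n
  have in_I: "from_nat_into I ` {..n} \<subseteq> I" for n
    using False by (auto intro: from_nat_into)
  have mU: "U n \<in> sets lebesgue" for n
    unfolding U_def using in_I B by (intro sets.finite_UN) auto
  have "(\<Union>i\<in>I. B i) = (\<Union>n. U n)"
  proof -
    have "(\<Union>i\<in>I. B i) = (\<Union>i\<in>range (from_nat_into I). B i)"
      unfolding range_from_nat_into[OF False I] ..
    also have "\<dots> = (\<Union>n. U n)" unfolding U_def by auto
    finally show ?thesis .
  qed
  moreover have "(\<Union>n. U n) \<in> sets lebesgue" using mU by auto
  moreover have "emeasure ?\<mu> (\<Union>n. U n) = (SUP n. emeasure ?\<mu> (U n))"
    using mU by (intro SUP_emeasure_incseq[symmetric]) (auto simp: U_def incseq_def, fastforce)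
  moreover have "emeasure ?\<mu> (U n) \<le> C" for n
  proof -
    have "emeasure ?\<mu> (U n) \<le> (\<Sum>i\<in>from_nat_into I ` {..n}. emeasure ?\<mu> (B i))"
      unfolding U_def using in_I B by (intro emeasure_subadditive_finite) auto
    also have "\<dots> = (\<Sum>i\<in>from_nat_into I ` {..n}. wmeas w (B i))"
      using in_I B by (intro sum.cong refl wmeas_density[symmetric] w) auto
    also have "\<dots> \<le> C" using in_I by (intro le) auto
    finally show ?thesis .
  qed
  ultimately show ?thesis
    using wmeas_density[OF w] by (simp add: SUP_least)
qed

text \<open>Take the least \<open>m\<close> with \<open>\<nu> / a ^ m \<le> \<gamma>\<close>. It is
  positive since \<open>\<gamma> < \<nu>\<close>, and its predecessor fails the inequality, which
  gives the upper bound.\<close>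

lemma geometric_bracket:
  fixes a \<nu> \<gamma> :: real
  assumes "1 < a" "0 < \<gamma>" "\<gamma> < \<nu>"
  obtains m :: nat where "\<nu> / a ^ m \<le> \<gamma>" "\<gamma> \<le> a * \<nu> / a ^ m"
proof -
  obtain N where "\<nu> / \<gamma> < a ^ N" using real_arch_pow[OF assms(1)] by blast
  then have ex: "\<nu> / a ^ N \<le> \<gamma>" using assms by (simp add: field_simps)
  define m where "m = (LEAST m. \<nu> / a ^ m \<le> \<gamma>)"
  have m: "\<nu> / a ^ m \<le> \<gamma>" unfolding m_def using ex by (rule LeastI)
  then have "m \<noteq> 0" using assms by (intro notI) simp
  then obtain k where k: "m = Suc k" using not0_implies_Suc by blast
  have "\<not> \<nu> / a ^ k \<le> \<gamma>" using not_less_Least[of k "\<lambda>m. \<nu> / a ^ m \<le> \<gamma>"] k unfolding m_def by simp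
  then have "\<gamma> \<le> a * \<nu> / a ^ m" using assms k by (simp add: field_simps)
  with m show ?thesis by (rule that)
qed

text \<open>Rounding up the logarithm places \<open>y\<close> in an interval closed on the right,
  which matches the condition in \<open>stopping_sublevel\<close>.\<close>

lemma geometric_threshold:
  fixes a y :: real
  assumes "1 < a" "0 < y"
  obtains k :: int where "a powi k < y" "y \<le> a powi (k + 1)"
proof -
  define k where "k = \<lceil>log a y\<rceil> - 1"
  have "a powr k < a powr (log a y)"
    using assms unfolding k_def by (intro powr_less_mono) linarith+
  moreover have "a powr (log a y) \<le> a powr (k + 1)"
    using assms unfolding k_def by (intro powr_mono) (linarith | simp)+
  moreover have "a powr (log a y) = y" using assms by simp
  ultimately show ?thesis
    using assms powr_real_of_int'[of a k] powr_real_of_int'[of a "k + 1"] that[of k] by simp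
qed

text \<open>Of the two conditions \<open>a ^ k < w x \<le> a ^ (k + 1)\<close> only the upper one is
  kept; the lower one serves to find a stopping cube of level \<open>k\<close> around
  \<open>x\<close>.\<close>

definition stopping_sublevel :: "(real^'n \<Rightarrow> real) \<Rightarrow> int \<times> (real^'n) set \<Rightarrow> (real^'n) set" where
  "stopping_sublevel w = (\<lambda>(k, Q). {x \<in> Q. w x \<le> stopping_ratio TYPE('n) powi (k + 1)})"

lemma stopping_sublevel_measurable:
  assumes "weight w" "snd i \<in> dyadic_cubes"
  shows "stopping_sublevel w i \<in> sets lebesgue"
proof -
  have "{x \<in> space lebesgue. w x \<le> stopping_ratio TYPE('a) powi (fst i + 1)} \<in> sets lebesgue"
    using weight_measurable[OF assms(1)] by measurable
  moreover have "stopping_sublevel w i = snd i \<inter> {x \<in> space lebesgue. w x \<le> stopping_ratio TYPE('a) powi (fst i + 1)}"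
    by (auto simp: stopping_sublevel_def split: prod.splits)
  ultimately show ?thesis using dyadic_cube_measurable[OF assms(2)] by simp
qed

text \<open>The number \<open>m\<close> measures how far \<open>G(Q)\<close> falls below
  \<open>wmeas w Q\<close>. Since \<open>Q\<close> is a stopping cube, \<open>a ^ (k + 1)\<close> is
  below \<open>a * avg Q G\<close>. If \<open>G(Q)\<close> is the smaller mass, this is at most
  \<open>a ^ 2 / a ^ m\<close> times the mean of \<open>w\<close>, and
  \<open>wmeas_sublevel_le\<close> applies with that factor as \<open>s\<close>.\<close>

lemma wmeas_stopping_sublevel:
  fixes w :: "real^'n \<Rightarrow> real"
  assumes w: "weight w" and p: "1 < p" and Ap: "Ap_const p w \<le> ennreal K" and K: "1 \<le> K"
    and fin: "(\<integral>\<^sup>+x. G x \<partial>lebesgue) < \<infinity>"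
    and Q: "Q \<in> stopping_cubes G k"
  shows "\<exists>m::nat. ennreal (1 / stopping_ratio TYPE('n) ^ m) * wmeas w Q \<le> (\<integral>\<^sup>+x\<in>Q. G x \<partial>lebesgue) \<and>
    wmeas w (stopping_sublevel w (k, Q)) \<le>
      ennreal (stopping_ratio TYPE('n) ^ 2 / stopping_ratio TYPE('n) ^ m *
        min 1 ((K * (stopping_ratio TYPE('n) ^ 2 / stopping_ratio TYPE('n) ^ m)) powr (1 / (p - 1)))) * wmeas w Q"
proof -
  define a where "a = stopping_ratio TYPE('n)"
  define B where "B = stopping_sublevel w (k, Q)"
  have a: "4 \<le> a" unfolding a_def by (rule stopping_ratio_ge)
  have Qd: "Q \<in> dyadic_cubes" using Q by (rule stopping_cubes_dyadic)
  obtain q where q: "0 < q" "emeasure lebesgue Q = ennreal q"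
    using emeasure_dyadic_cube[OF Qd] .
  obtain \<nu> where \<nu>: "wmeas w Q = ennreal \<nu>" "0 \<le> \<nu>"
    using wmeas_dyadic_finite[OF w Qd] by (cases "wmeas w Q") auto
  have "(\<integral>\<^sup>+x\<in>Q. G x \<partial>lebesgue) \<le> (\<integral>\<^sup>+x. G x \<partial>lebesgue)"
    by (intro nn_integral_mono) (auto simp: indicator_def)
  then obtain \<gamma> where \<gamma>: "(\<integral>\<^sup>+x\<in>Q. G x \<partial>lebesgue) = ennreal \<gamma>" "0 \<le> \<gamma>"
    using fin by (cases "\<integral>\<^sup>+x\<in>Q. G x \<partial>lebesgue") (auto simp: top_unique)
  have BQ: "B \<subseteq> Q" by (auto simp: B_def stopping_sublevel_def)
  have "ennreal (a powi k) < ennreal (\<gamma> / q)"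
    using stopping_cubes_avg[OF Q] \<gamma> q by (simp add: avg_def a_def divide_ennreal)
  then have ak: "a powi k < \<gamma> / q" using a by (simp add: ennreal_less_iff)
  moreover have "0 < a powi k" using a by simp
  ultimately have "0 < \<gamma> / q" by linarith
  then have \<gamma>0: "0 < \<gamma>" using q(1) by (simp add: zero_less_divide_iff)
  show ?thesis
  proof (cases "\<nu> \<le> \<gamma>")
    \<comment> \<open>If \<open>G(Q)\<close> is at least \<open>wmeas w Q\<close>, then
      \<open>m = 0\<close> works: the minimum is 1, and \<open>wmeas w Q\<close> itself is below the
      claimed bound.\<close>
    case True
    have "1 * 1 \<le> K * a^2" using K a by (intro mult_mono one_le_power) auto
    then have "min 1 ((K * (a^2 / a^0)) powr (1 / (p - 1))) = 1"
      using p by (simp add: ge_one_powr_ge_zero)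
    moreover have "wmeas w B \<le> ennreal (a^2) * wmeas w Q"
    proof -
      have "wmeas w B \<le> 1 * wmeas w Q" using BQ by (simp add: wmeas_mono)
      also have "\<dots> \<le> ennreal (a^2) * wmeas w Q"
        using a by (intro mult_right_mono) (simp_all add: one_le_power)
      finally show ?thesis .
    qed
    ultimately show ?thesis
      unfolding a_def[symmetric] B_def[symmetric]
      using True \<nu> \<gamma> by (intro exI[of _ 0]) (simp add: ennreal_leI)
  next
    case False
    then have "\<gamma> < \<nu>" "1 < a" using a by auto
    then obtain m where m: "\<nu> / a ^ m \<le> \<gamma>" "\<gamma> \<le> a * \<nu> / a ^ m"
      using geometric_bracket \<gamma>0 by metis
    define s where "s = a^2 / a^m"
    have s: "0 < s" using a by (simp add: s_def)
    have "a powi (k + 1) = a * a powi k" using a by (simp add: power_int_add)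
    also have "\<dots> \<le> a * (\<gamma> / q)" using ak a by (intro mult_left_mono) auto
    also have "\<dots> \<le> a * (a * \<nu> / a ^ m / q)" using m(2) a q(1) by (intro mult_left_mono divide_right_mono) auto
    also have "\<dots> = s * \<nu> / q" by (simp add: s_def power2_eq_square)
    finally have "B \<subseteq> {x \<in> Q. w x \<le> s * \<nu> / q}"
      by (auto simp: B_def stopping_sublevel_def a_def)
    then have "wmeas w B \<le> wmeas w {x \<in> Q. w x \<le> s * \<nu> / q}" by (rule wmeas_mono)
    also have "\<dots> \<le> ennreal (s * min 1 ((K * s) powr (1 / (p - 1))) * \<nu>)"
      using wmeas_sublevel_le[OF w p Ap _ s Qd q(2,1) \<nu>] K by simp
    also have "\<dots> = ennreal (s * min 1 ((K * s) powr (1 / (p - 1)))) * wmeas w Q"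
      unfolding \<nu>(1) using \<nu>(2) by (rule ennreal_mult'')
    finally have "wmeas w B \<le> \<dots>" .
    moreover have "ennreal (1 / a ^ m) * wmeas w Q \<le> (\<integral>\<^sup>+x\<in>Q. G x \<partial>lebesgue)"
      unfolding \<nu>(1) \<gamma>(1) using m(1) \<nu>(2) by (simp add: ennreal_mult''[symmetric] ennreal_leI)
    ultimately show ?thesis
      unfolding a_def[symmetric] B_def[symmetric] s_def by blast
  qed
qed

text \<open>Group the cubes by \<open>m\<close>. The factor \<open>1 / a ^ m\<close> in the sublevel
  bound is the one on the left of the packing estimate for the group, which therefore contributes at
  most \<open>a ^ 2 * \<tau> m\<close> times \<open>2 * Ainf_const w * \<integral>G\<close>. Summing
  the minima gives the constant \<open>10 = 2 * 5\<close>.\<close>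

lemma sum_wmeas_stopping_sublevel:
  fixes w :: "real^'n \<Rightarrow> real"
  assumes w: "weight w" and p: "1 < p" and Ap: "Ap_const p w \<le> ennreal K" and K: "1 \<le> K"
    and G: "G \<in> borel_measurable lebesgue" and fin: "(\<integral>\<^sup>+x. G x \<partial>lebesgue) < \<infinity>"
    and F: "finite F" "F \<subseteq> Sigma UNIV (stopping_cubes G)"
  shows "(\<Sum>i\<in>F. wmeas w (stopping_sublevel w i)) \<le>
    ennreal (10 * stopping_ratio TYPE('n) ^ 2 * max p (ln K)) * (Ainf_const w * (\<integral>\<^sup>+x. G x \<partial>lebesgue))"
proof -
  define a where "a = stopping_ratio TYPE('n)"
  define X where "X = 2 * Ainf_const w * (\<integral>\<^sup>+x. G x \<partial>lebesgue)"
  define \<tau> where "\<tau> m = min 1 ((K * (a^2 / a^m)) powr (1 / (p - 1)))" for m :: nat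
  have a: "4 \<le> a" unfolding a_def by (rule stopping_ratio_ge)
  have \<tau>0: "0 \<le> \<tau> m" for m by (simp add: \<tau>_def)
  have FQ: "snd i \<in> stopping_cubes G (fst i)" if "i \<in> F" for i using F(2) that by auto
  then have "\<forall>i\<in>F. \<exists>m::nat. ennreal (1 / a ^ m) * wmeas w (snd i) \<le> (\<integral>\<^sup>+x\<in>snd i. G x \<partial>lebesgue) \<and>
    wmeas w (stopping_sublevel w i) \<le> ennreal (a^2 / a^m * \<tau> m) * wmeas w (snd i)"
    using wmeas_stopping_sublevel[OF w p Ap K fin FQ] unfolding a_def \<tau>_def by simp
  from bchoice[OF this] obtain m where m': "\<forall>i\<in>F. ennreal (1 / a ^ m i) * wmeas w (snd i) \<le> (\<integral>\<^sup>+x\<in>snd i. G x \<partial>lebesgue) \<and>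
    wmeas w (stopping_sublevel w i) \<le> ennreal (a^2 / a^m i * \<tau> (m i)) * wmeas w (snd i)" ..
  have m: "ennreal (1 / a ^ m i) * wmeas w (snd i) \<le> (\<integral>\<^sup>+x\<in>snd i. G x \<partial>lebesgue)"
    "wmeas w (stopping_sublevel w i) \<le> ennreal (a^2 / a^m i * \<tau> (m i)) * wmeas w (snd i)" if "i \<in> F" for i
    using bspec[OF m' that] by simp_all
  \<comment> \<open>The part of a cube not reached by the next level. Different levels give disjoint
    sets because the unions decrease, equal levels because their stopping cubes are
    disjoint.\<close>
  define E where "E i = snd i - stopping_union G (fst i + 1)" for i
  have disE: "disjoint_family_on E F"
    unfolding disjoint_family_on_def
  proof (intro ballI impI)
    have *: "E i \<inter> E j = {}" if "i \<in> F" "j \<in> F" "fst i < fst j" for i j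
    proof -
      have "snd j \<subseteq> stopping_union G (fst j)" using FQ[OF that(2)] by (auto simp: stopping_union_def)
      also have "\<dots> \<subseteq> stopping_union G (fst i + 1)"
        using that(3) by (intro stopping_union_antimono fin) simp
      finally show ?thesis by (auto simp: E_def)
    qed
    fix i j assume ij: "i \<in> F" "j \<in> F" "i \<noteq> j"
    consider "fst i < fst j" | "fst j < fst i" | "fst i = fst j" by linarith
    then show "E i \<inter> E j = {}"
    proof cases
      case 3
      then have "snd i \<noteq> snd j" using ij(3) by (simp add: prod_eq_iff)
      then have "snd i \<inter> snd j = {}"
        using stopping_cubes_disjoint[of "snd i" G "fst i" "snd j"] FQ[OF ij(1)] FQ[OF ij(2)] 3 by simp
      then show ?thesis by (auto simp: E_def)
    qed (use * ij in blast)+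
  qed
  have packing: "ennreal (1 / a ^ l) * (\<Sum>i | i \<in> F \<and> m i = l. wmeas w (snd i)) \<le> X" for l
    unfolding X_def
  proof (rule carleson_packing[OF w, where E=E])
    show "disjoint_family_on E {i \<in> F. m i = l}"
      using disE by (rule disjoint_family_on_mono[rotated]) auto
    show "finite {i \<in> F. m i = l}" using F(1) by simp
  next
    fix i assume "i \<in> {i \<in> F. m i = l}"
    then have i: "i \<in> F" "m i = l" by simp_all
    show d: "snd i \<in> dyadic_cubes" using FQ[OF i(1)] by (rule stopping_cubes_dyadic)
    show "E i \<in> sets lebesgue"
      unfolding E_def using dyadic_cube_measurable[OF d] stopping_union_measurable by (rule sets.Diff)
    show "E i \<subseteq> snd i" by (auto simp: E_def)
    show "emeasure lebesgue (snd i) \<le> 2 * emeasure lebesgue (E i)"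
      unfolding E_def by (rule stopping_cubes_sparse[OF G FQ[OF i(1)]])
    show "ennreal (1 / a ^ l) * wmeas w (snd i) \<le> (\<integral>\<^sup>+x\<in>snd i. G x \<partial>lebesgue)"
      using m(1)[OF i(1)] i(2) by simp
  qed (rule G)
  have "(\<Sum>i\<in>F. wmeas w (stopping_sublevel w i)) \<le> (\<Sum>i\<in>F. ennreal (a^2 / a^m i * \<tau> (m i)) * wmeas w (snd i))"
    using m(2) by (rule sum_mono)
  also have "\<dots> = (\<Sum>l\<in>m ` F. \<Sum>i | i \<in> F \<and> m i = l. ennreal (a^2 / a^m i * \<tau> (m i)) * wmeas w (snd i))"
    using F(1) by (rule sum.image_gen)
  also have "\<dots> \<le> (\<Sum>l\<in>m ` F. ennreal (a^2 * \<tau> l) * X)"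
  proof (rule sum_mono)
    fix l
    have "(\<Sum>i | i \<in> F \<and> m i = l. ennreal (a^2 / a^m i * \<tau> (m i)) * wmeas w (snd i)) =
        (\<Sum>i | i \<in> F \<and> m i = l. ennreal (a^2 * \<tau> l) * (ennreal (1 / a^l) * wmeas w (snd i)))"
    proof (rule sum.cong[OF refl])
      fix i assume "i \<in> {i \<in> F. m i = l}"
      then have "m i = l" by simp
      moreover have "ennreal (a^2 / a^l * \<tau> l) = ennreal (a^2 * \<tau> l) * ennreal (1 / a^l)"
        using a \<tau>0 by (simp add: ennreal_mult''[symmetric] ennreal_mult'[symmetric])
      ultimately show "ennreal (a^2 / a^m i * \<tau> (m i)) * wmeas w (snd i) =
          ennreal (a^2 * \<tau> l) * (ennreal (1 / a^l) * wmeas w (snd i))"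
        by (simp add: mult.assoc)
    qed
    also have "\<dots> = ennreal (a^2 * \<tau> l) * (ennreal (1 / a^l) * (\<Sum>i | i \<in> F \<and> m i = l. wmeas w (snd i)))"
      by (simp add: sum_distrib_left)
    also have "\<dots> \<le> ennreal (a^2 * \<tau> l) * X"
      using packing by (rule mult_left_mono) simp
    finally show "(\<Sum>i | i \<in> F \<and> m i = l. ennreal (a^2 / a^m i * \<tau> (m i)) * wmeas w (snd i)) \<le> ennreal (a^2 * \<tau> l) * X" .
  qed
  also have "\<dots> = ennreal (a^2 * (\<Sum>l\<in>m ` F. \<tau> l)) * X"
    unfolding sum_distrib_right[symmetric] sum_distrib_left using \<tau>0 by (subst sum_ennreal) auto
  also have "\<dots> \<le> ennreal (a^2 * (5 * max p (ln K))) * X"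
    using sum_min_geometric[OF p K a, of "m ` F"] F(1) unfolding \<tau>_def
    by (intro mult_right_mono ennreal_leI mult_left_mono) auto
  also have "\<dots> = ennreal (a^2 * (5 * max p (ln K))) * ennreal 2 * (Ainf_const w * (\<integral>\<^sup>+x. G x \<partial>lebesgue))"
    by (simp add: X_def mult.assoc)
  also have "ennreal (a^2 * (5 * max p (ln K))) * ennreal 2 = ennreal (10 * a^2 * max p (ln K))"
    by (subst ennreal_mult''[symmetric]) (auto intro: arg_cong[where f=ennreal])
  finally show ?thesis unfolding a_def .
qed

text \<open>Points with \<open>w x = 0\<close> carry no mass. Elsewhere let
  \<open>a ^ k < w x \<le> a ^ (k + 1)\<close>: the cube around \<open>x\<close> with average above
  \<open>w x\<close> lies in a stopping cube of level \<open>k\<close>, so \<open>x\<close> is in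
  one of countably many stopping sublevel sets.\<close>

lemma wmeas_dyadic_maximal_gt:
  fixes w :: "real^'n \<Rightarrow> real"
  assumes w: "weight w" and p: "1 < p" and Ap: "Ap_const p w \<le> ennreal K" and K: "1 \<le> K"
    and G: "G \<in> borel_measurable lebesgue" and fin: "(\<integral>\<^sup>+x. G x \<partial>lebesgue) < \<infinity>"
    and A: "\<And>x. x \<in> A \<Longrightarrow> 0 < w x \<Longrightarrow> \<exists>Q\<in>dyadic_cubes. x \<in> Q \<and> ennreal (w x) < avg Q G"
  shows "wmeas w A \<le>
    ennreal (10 * stopping_ratio TYPE('n) ^ 2 * max p (ln K)) * (Ainf_const w * (\<integral>\<^sup>+x. G x \<partial>lebesgue))"
proof -
  define I where "I = Sigma UNIV (stopping_cubes G)"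
  have a: "1 < stopping_ratio TYPE('n)" using stopping_ratio_ge[where 'n='n] by linarith
  have cover: "x \<in> (\<Union>i\<in>I. stopping_sublevel w i)" if x: "x \<in> A" "0 < w x" for x
  proof -
    obtain Q where Q: "Q \<in> dyadic_cubes" "x \<in> Q" "ennreal (w x) < avg Q G" using A[OF x] by blast
    obtain k where k: "stopping_ratio TYPE('n) powi k < w x" "w x \<le> stopping_ratio TYPE('n) powi (k + 1)"
      using geometric_threshold[OF a x(2)] by metis
    have "ennreal (stopping_ratio TYPE('n) powi k) < avg Q G"
      using k(1) Q(3) ennreal_leI[of "stopping_ratio TYPE('n) powi k" "w x"] by (meson less_imp_le le_less_trans)
    then obtain R where "R \<in> stopping_cubes G k" "Q \<subseteq> R"
      using stopping_cubes_cover[OF fin Q(1,2)] by metis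
    then show ?thesis using k(2) Q(2) unfolding I_def stopping_sublevel_def by fastforce
  qed
  \<comment> \<open>The integrands are compared pointwise, which works for an arbitrary set
    \<open>A\<close>.\<close>
  have "ennreal (w x) * indicator A x \<le> ennreal (w x) * indicator (\<Union>i\<in>I. stopping_sublevel w i) x" for x
    using cover[of x] by (cases "0 < w x") (auto simp: indicator_def ennreal_neg)
  then have "wmeas w A \<le> wmeas w (\<Union>i\<in>I. stopping_sublevel w i)"
    unfolding wmeas_def by (intro nn_integral_mono)
  also have "\<dots> \<le> ennreal (10 * stopping_ratio TYPE('n) ^ 2 * max p (ln K)) * (Ainf_const w * (\<integral>\<^sup>+x. G x \<partial>lebesgue))"
  proof (rule wmeas_UN_le[OF w])
    show "countable I" unfolding I_def by (intro countable_SIGMA countable_stopping_cubes) simp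
    show "stopping_sublevel w i \<in> sets lebesgue" if "i \<in> I" for i
      using that by (intro stopping_sublevel_measurable w) (auto simp: I_def intro: stopping_cubes_dyadic)
  qed (use sum_wmeas_stopping_sublevel[OF w p Ap K G fin] in \<open>simp add: I_def\<close>)
  finally show ?thesis .
qed

text \<open>Dividing \<open>f v\<close> by \<open>t\<close> normalizes the level: where
  \<open>v\<close> is positive, the quotient exceeds \<open>t\<close> only if the dyadic maximal
  function of \<open>G\<close> exceeds \<open>v\<close>. The factor \<open>1 / t\<close> in the
  integral of \<open>G\<close> cancels the \<open>t\<close> of the weak norm.\<close>

lemma weak_L1_norm_dyadic_maximal_le:
  fixes v f :: "real^'n \<Rightarrow> real"
  assumes v: "weight v" and p: "1 < p" and Ap: "Ap_const p v \<le> ennreal K" and K: "1 \<le> K"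
    and f: "in_L1 v f"
  shows "weak_L1_norm v (\<lambda>x. dyadic_maximal (\<lambda>y. f y * v y) x / ennreal (v x)) \<le>
    ennreal (10 * stopping_ratio TYPE('n) ^ 2 * max p (ln K)) * (Ainf_const v * L1_norm v f)"
  unfolding weak_L1_norm_def
proof (rule SUP_least)
  fix t :: real assume "t \<in> {0<..}"
  then have t: "0 < t" by simp
  let ?g = "\<lambda>y. ennreal \<bar>f y * v y\<bar>"
  define G where "G y = ennreal (1 / t) * ?g y" for y
  have mg: "?g \<in> borel_measurable lebesgue"
  proof -
    have [measurable]: "v \<in> borel_measurable lebesgue" "f \<in> borel_measurable lebesgue"
      using weight_measurable[OF v] f by (auto simp: in_L1_def)
    show ?thesis by measurable
  qed
  have mG: "G \<in> borel_measurable lebesgue" unfolding G_def using mg by measurable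
  have v0: "0 \<le> v x" for x using v by (simp add: weight_def)
  have norm: "L1_norm v f = (\<integral>\<^sup>+x. ?g x \<partial>lebesgue)"
    unfolding L1_norm_def using v0 by (simp add: abs_mult)
  have intG: "(\<integral>\<^sup>+x. G x \<partial>lebesgue) = ennreal (1 / t) * L1_norm v f"
    unfolding G_def norm using mg by (rule nn_integral_cmult)
  have fin: "(\<integral>\<^sup>+x. G x \<partial>lebesgue) < \<infinity>"
    using f unfolding intG in_L1_def by (simp add: ennreal_mult_less_top)
  have avgG: "avg Q G = ennreal (1 / t) * avg Q ?g" if "Q \<in> dyadic_cubes" for Q
  proof -
    have "(\<lambda>x. ?g x * indicator Q x) \<in> borel_measurable lebesgue"
      using mg dyadic_cube_measurable[OF that] by measurable
    then have "(\<integral>\<^sup>+x. ennreal (1 / t) * (?g x * indicator Q x) \<partial>lebesgue) =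
        ennreal (1 / t) * (\<integral>\<^sup>+x\<in>Q. ?g x \<partial>lebesgue)"
      by (rule nn_integral_cmult)
    then show ?thesis by (simp add: avg_def G_def mult.assoc ennreal_times_divide)
  qed
  define A where "A = {x. ennreal t < dyadic_maximal (\<lambda>y. f y * v y) x / ennreal (v x)}"
  have "wmeas v A \<le> ennreal (10 * stopping_ratio TYPE('n) ^ 2 * max p (ln K)) * (Ainf_const v * (\<integral>\<^sup>+x. G x \<partial>lebesgue))"
  proof (rule wmeas_dyadic_maximal_gt[OF v p Ap K mG fin])
    fix x assume x: "x \<in> A" "0 < v x"
    let ?M = "dyadic_maximal (\<lambda>y. f y * v y) x"
    have "ennreal (t * v x) < ?M"
    proof (rule ccontr)
      assume "\<not> ?thesis"
      then have "?M / ennreal (v x) \<le> ennreal (t * v x) / ennreal (v x)"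
        by (intro divide_right_mono_ennreal) simp
      also have "\<dots> = ennreal t" using x(2) t by (simp add: divide_ennreal)
      finally show False using x(1) by (simp add: A_def)
    qed
    then obtain Q where Q: "Q \<in> dyadic_cubes" "x \<in> Q" "ennreal (t * v x) < avg Q ?g"
      unfolding dyadic_maximal_def maximal_op_def less_SUP_iff by auto
    have "ennreal (v x) = ennreal (1 / t) * ennreal (t * v x)"
      using t x(2) by (simp add: ennreal_mult''[symmetric])
    also have "\<dots> < ennreal (1 / t) * avg Q ?g"
      using Q(3) t by (intro ennreal_mult_strict_left_mono) auto
    finally show "\<exists>Q\<in>dyadic_cubes. x \<in> Q \<and> ennreal (v x) < avg Q G"
      using Q(1,2) avgG by auto
  qed
  then have "ennreal t * wmeas v A \<le> ennreal t * (ennreal (10 * stopping_ratio TYPE('n) ^ 2 * max p (ln K)) *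
      (Ainf_const v * (ennreal (1 / t) * L1_norm v f)))"
    unfolding intG by (rule mult_left_mono) simp
  also have "\<dots> = (ennreal t * ennreal (1 / t)) * (ennreal (10 * stopping_ratio TYPE('n) ^ 2 * max p (ln K)) *
      (Ainf_const v * L1_norm v f))"
    by (simp only: ac_simps)
  also have "ennreal t * ennreal (1 / t) = 1" using t by (simp add: ennreal_mult''[symmetric])
  finally show "ennreal t * wmeas v {x. ennreal t < dyadic_maximal (\<lambda>y. f y * v y) x / ennreal (v x)}
      \<le> ennreal (10 * stopping_ratio TYPE('n) ^ 2 * max p (ln K)) * (Ainf_const v * L1_norm v f)"
    by (simp add: A_def)
qed

theorem theorem1p13:
  shows "\<exists>c::real. 0 < c \<and>
    (\<forall>(p::real) (v :: real^'n \<Rightarrow> real) (f :: real^'n \<Rightarrow> real).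
      1 \<le> p \<longrightarrow> Ap_weight p v \<longrightarrow> in_L1 v f \<longrightarrow>
      weak_L1_norm v (\<lambda>x. dyadic_maximal (\<lambda>y. f y * v y) x / ennreal (v x))
        \<le> ennreal c * Ainf_const v
            * ennreal (max p (ln (exp 1 + enn2real (Ap_const p v)))) * L1_norm v f)"
proof (intro exI[of _ "20 * stopping_ratio TYPE('n) ^ 2"] conjI allI impI)
  show "0 < 20 * stopping_ratio TYPE('n) ^ 2" using stopping_ratio_ge[where 'n='n] by simp
next
  fix p :: real and v f :: "real^'n \<Rightarrow> real"
  assume p: "1 \<le> p" and "Ap_weight p v" and f: "in_L1 v f"
  then have v: "weight v" and fin: "Ap_const p v < \<infinity>" by (auto simp: Ap_weight_def)
  define K where "K = exp 1 + enn2real (Ap_const p v)"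
  have K: "exp 1 \<le> K" by (simp add: K_def)
  have K1: "1 \<le> K" using K one_le_exp_iff[of "1::real"] by linarith
  have lnK: "1 \<le> ln K" using K K1 by (subst ln_ge_iff) auto
  \<comment> \<open>\<open>enn2real\<close> sends infinity to 0, so it is finiteness of the constant
    that makes \<open>K\<close> a bound for it.\<close>
  have "Ap_const p v = ennreal (enn2real (Ap_const p v))" using fin by simp
  also have "\<dots> \<le> ennreal K" by (intro ennreal_leI) (simp add: K_def)
  finally have Ap: "Ap_const p v \<le> ennreal K" .
  \<comment> \<open>For \<open>p = 1\<close> the exponent 2 takes over. This at most doubles the
    maximum, so 10 becomes 20.\<close>
  define r where "r = (if p = 1 then 2 else p)"
  have r: "1 < r" "max r (ln K) \<le> 2 * max p (ln K)" using p lnK by (auto simp: r_def)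
  have "Ap_const r v \<le> ennreal K"
    using Ap Ap_const_2_le_A1[OF v] by (auto simp: r_def)
  from weak_L1_norm_dyadic_maximal_le[OF v r(1) this K1 f]
  have "weak_L1_norm v (\<lambda>x. dyadic_maximal (\<lambda>y. f y * v y) x / ennreal (v x)) \<le>
    ennreal (10 * stopping_ratio TYPE('n) ^ 2 * max r (ln K)) * (Ainf_const v * L1_norm v f)" .
  also have "\<dots> \<le> ennreal (20 * stopping_ratio TYPE('n) ^ 2 * max p (ln K)) * (Ainf_const v * L1_norm v f)"
  proof (intro mult_right_mono ennreal_leI)
    have "10 * stopping_ratio TYPE('n) ^ 2 * max r (ln K) \<le> 10 * stopping_ratio TYPE('n) ^ 2 * (2 * max p (ln K))"
      using r(2) by (intro mult_left_mono) auto
    then show "10 * stopping_ratio TYPE('n) ^ 2 * max r (ln K) \<le> 20 * stopping_ratio TYPE('n) ^ 2 * max p (ln K)" by simp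
  qed simp
  also have "ennreal (20 * stopping_ratio TYPE('n) ^ 2 * max p (ln K)) =
      ennreal (20 * stopping_ratio TYPE('n) ^ 2) * ennreal (max p (ln K))"
    using p by (intro ennreal_mult'') simp
  finally show "weak_L1_norm v (\<lambda>x. dyadic_maximal (\<lambda>y. f y * v y) x / ennreal (v x))
        \<le> ennreal (20 * stopping_ratio TYPE('n) ^ 2) * Ainf_const v
            * ennreal (max p (ln (exp 1 + enn2real (Ap_const p v)))) * L1_norm v f"
    unfolding K_def by (simp only: ac_simps)
qed

end
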